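(* Let $X$ be an Asplund space and $f\colon T\times X\to\overline{\mathbb{R}}$ an admissible integrand. Regard $\mathcal{I}_f$ as a functional on $L^\infty(T,X)$ and assume that $\mathcal{I}_f(u)<+\infty$ for some $u\in L^\infty(T,X)$. Then for every $x^\ast\in L^1(T,X^\ast)$ and $\lambda^\ast\in L^{\mathrm{sing}}(T,X)$, $$(\mathcal{I}_f)^\ast(x^\ast+\lambda^\ast)=\mathcal{I}_{f^\ast}(x^\ast)+\sigma_{\operatorname{dom}\mathcal{I}_f}(\lambda^\ast).$$ Moreover, for all $\epsilon\ge0$ and $x\in\operatorname{dom}\mathcal{I}_f\cap L^\infty(T,X)$, if $v^\ast\in L^1(T,X^\ast)$ and $\lambda^\ast\in L^{\mathrm{sing}}(T,X)$, then $v^\ast+\lambda^\ast\in\partial_\epsilon\mathcal{I}_f(x)$ if and only if there exist $\epsilon_1,\epsilon_2\ge0$ with $\epsilon_1+\epsilon_2\le\epsilon$ and $\ell\in\mathcal{Z}(\epsilon_1)$ such that $$v^\ast(t)\in\partial_{\ell(t)}f_t(x(t))\ \text{ for } \mu\text{-a.e. } t\in T\quad\text{and}\quad \lambda^\ast\in N^{\epsilon_2}_{\operatorname{dom}\mathcal{I}_f}(x).$$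
   Context: Standing assumptions: $X$ is a (not necessarily separable) Banach space with dual $X^\ast$, $(T,d)$ is a metric space, and $(T,\mathcal{A},\mu)$ is a complete $\sigma$-finite measure space with $\mathcal{A}$ containing the Borel $\sigma$-algebra of $T$; $\mu$ is inner regular, meaning that for all $\varepsilon>0$ and $B\in\mathcal{A}$ of finite measure there is a compact $K\subset B$ with $\mu(B\setminus K)<\varepsilon$. Notation: $\overline{\mathbb{R}}=[-\infty,\infty]$; $f_t(x):=f(t,x)$; $\operatorname{epi} g:=\{(x,\alpha)\in X\times\mathbb{R}: g(x)\le\alpha\}$; $g^\ast(x^\ast):=\sup_{x}\{\langle x^\ast,x\rangle-g(x)\}$; $\mathcal{I}_f(x):=\int_T f_t(x(t))\,d\mu$, $\mathcal{I}_{f^\ast}(x^\ast):=\int_T f^\ast_t(x^\ast(t))\,d\mu$; $\operatorname{dom}\mathcal{I}_f=\{x:\mathcal{I}_f(x)<+\infty\}$. Integrals are upper integrals: $\int_T g\,d\mu:=\int_T\max\{g,0\}\,d\mu+\int_T\min\{g,0\}\,d\mu$ with $+\infty+(-\infty)=+\infty$. $\mathcal{Z}(\epsilon):=\{\ell\in L^1(T):\ell\ge0\ \mu\text{-a.e., }\int_T\ell\,d\mu\le\epsilon\}$. $\delta_C$ is $0$ on $C$ and $+\infty$ off $C$, $\sigma_C:=(\delta_C)^\ast$ is the support function. For $g\colon Z\to\overline{\mathbb{R}}$ on a Banach space $Z$, $\epsilon\ge0$ and $z$ with $|g(z)|<\infty$: $\partial_\epsilon g(z):=\{z^\ast\in Z^\ast:\langle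 z^\ast,y-z\rangle\le g(y)-g(z)+\epsilon\ \forall y\in Z\}$; $\partial_\epsilon g(z):=\emptyset$ if $|g(z)|=\infty$. For $C\subset Z$ and $z\in C$, $N_C^\epsilon(z):=\partial_\epsilon\delta_C(z)$. Elements $x^\ast\in L^1(T,X^\ast)$ act on $L^\infty(T,X)$ by $x\mapsto\int_T\langle x^\ast(t),x(t)\rangle\,d\mu$. An element $\lambda\in L^\infty(T,X)^\ast$ is a singular measure (with respect to $\mu$), $\lambda\in L^{\mathrm{sing}}(T,X)$, if there is an increasing sequence of measurable sets $(A_n)$ with $T=\bigcup_nA_n$ such that for all $n$ and all $A\in\mathcal{A}$ with $\mu(A)<\infty$, $\langle\lambda,x\mathbf{1}_{A_n\cap A}\rangle=0$ for all $x\in L^\infty(T,X)$. A multifunction $\Phi$ is lower semicontinuous (lsc) at $t$ if for every open $V$ with $\Phi(t)\cap V\ne\emptyset$ there is a neighbourhood $U$ of $t$ with $\Phi(s)\cap V\neq\emptyset$ for all $s\in U$; it is lsc if it is lsc at every point where its value is nonempty. A family $(f^i\colon T\times X\to\overline{\mathbb{R}})_{i\in I}$ is a uniform Lusin family if for every $\varepsilon>0$ and every $A\in\mathcal{A}$ of finite measure there is a compact $B\subset A$ with $\mu(A\setminus B)<\varepsilon$ such that $B\ni t\rightrightarrows\operatorname{epi} f^i_t$ is lsc for all $i\in I$. $\Gamma(X)$ is the set of convex lower semicontinuous functions $X\to\overline{\mathbb{R}}$ (not necessarily proper). $f$ is an admissible integrand if there is a uniform Lusin family $(f^i)_{i\in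 I}$ with $f^i_t\in\Gamma(X)$ for all $i\in I$, $t\in T$, and $\operatorname{epi} f_t=\operatorname{cl}\big(\operatorname{epi}(\inf_{i\in I}f^i_t)\big)$ for all $t\in T$.
   Formalization: In the subdifferential part, I_f(x) > -∞ is additionally assumed; without it the "if" direction fails, e.g. T=(0,1), f_t(x) = -1/t, x = 0, v* = 0, λ* = 0, where I_f ≡ -∞ and its ε-subdifferential is empty by convention. *)

theory Defs
  imports "HOL-Analysis.Analysis"
begin

definition Asplund_space :: "'x::banach itself \<Rightarrow> bool" where
  "Asplund_space _ \<longleftrightarrow>
     (\<forall>(U :: 'x set) (\<phi> :: 'x \<Rightarrow> real).
        open U \<and> U \<noteq> {} \<and> convex_on U \<phi> \<and> continuous_on U \<phi> \<longrightarrow>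
          (\<exists>G. gdelta G \<and> G \<subseteq> U \<and> U \<subseteq> closure G \<and> (\<forall>x\<in>G. \<phi> differentiable (at x))))"

definition inner_regular_measure :: "'t::metric_space measure \<Rightarrow> bool" where
  "inner_regular_measure M \<longleftrightarrow>
     (\<forall>\<epsilon>::real. 0 < \<epsilon> \<longrightarrow> (\<forall>B\<in>sets M. emeasure M B < \<infinity> \<longrightarrow>
        (\<exists>K. compact K \<and> K \<subseteq> B \<and> emeasure M (B - K) < ennreal \<epsilon>)))"

definition epi :: "('x \<Rightarrow> ereal) \<Rightarrow> ('x \<times> real) set" where
  "epi g = {(x, \<alpha>). g x \<le> ereal \<alpha>}"

text \<open>Convexity is expressed by the epigraph, since functions may take both infinite values.\<close>

definition Gamma_fun :: "('x::real_normed_vector \<Rightarrow> ereal) set" where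
  "Gamma_fun = {g. convex (epi g) \<and> (\<forall>x. \<forall>a < g x. \<forall>\<^sub>F y in nhds x. a < g y)}"

definition lsc_multifun_at :: "'t::topological_space set \<Rightarrow> ('t \<Rightarrow> 'y::topological_space set) \<Rightarrow> 't \<Rightarrow> bool" where
  "lsc_multifun_at B \<Phi> t \<longleftrightarrow>
     (\<forall>V. open V \<and> \<Phi> t \<inter> V \<noteq> {} \<longrightarrow> (\<exists>U. open U \<and> t \<in> U \<and> (\<forall>s\<in>U \<inter> B. \<Phi> s \<inter> V \<noteq> {})))"

definition lsc_multifun_on :: "'t::topological_space set \<Rightarrow> ('t \<Rightarrow> 'y::topological_space set) \<Rightarrow> bool" where
  "lsc_multifun_on B \<Phi> \<longleftrightarrow> (\<forall>t\<in>B. \<Phi> t \<noteq> {} \<longrightarrow> lsc_multifun_at B \<Phi> t)"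

definition uniform_Lusin_family ::
    "'t::metric_space measure \<Rightarrow> 'i set \<Rightarrow> ('i \<Rightarrow> 't \<Rightarrow> 'x::real_normed_vector \<Rightarrow> ereal) \<Rightarrow> bool" where
  "uniform_Lusin_family M I F \<longleftrightarrow>
     (\<forall>\<epsilon>::real. 0 < \<epsilon> \<longrightarrow> (\<forall>A\<in>sets M. emeasure M A < \<infinity> \<longrightarrow>
        (\<exists>B. compact B \<and> B \<subseteq> A \<and> emeasure M (A - B) < ennreal \<epsilon> \<and>
             (\<forall>i\<in>I. lsc_multifun_on B (\<lambda>t. epi (F i t))))))"

text \<open>
  All conditions on the family depend only on the set of its members, so taking the index set
  among sets of integrands loses no generality: any family may be indexed by its own range.
\<close>

definition admissible_integrand ::
    "'t::metric_space measure \<Rightarrow> ('t \<Rightarrow> 'x::real_normed_vector \<Rightarrow> ereal) \<Rightarrow> bool" where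
  "admissible_integrand M f \<longleftrightarrow>
     (\<exists>(I :: ('t \<Rightarrow> 'x \<Rightarrow> ereal) set) F.
        uniform_Lusin_family M I F \<and>
        (\<forall>i\<in>I. \<forall>t. F i t \<in> Gamma_fun) \<and>
        (\<forall>t. epi (f t) = closure (epi (\<lambda>x. INF i\<in>I. F i t x))))"

text \<open>
  The convention \<open>\<infinity> + -\<infinity> = \<infinity>\<close> is the one of addition on type \<open>ereal\<close>.
\<close>

definition upper_integral :: "'t measure \<Rightarrow> ('t \<Rightarrow> ereal) \<Rightarrow> ereal" where
  "upper_integral M g =
     enn2ereal (\<integral>\<^sup>+ t. e2ennreal (max (g t) 0) \<partial>M) +
     - enn2ereal (\<integral>\<^sup>+ t. e2ennreal (- min (g t) 0) \<partial>M)"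

text \<open>
  Bochner measurability. The target space need not be separable, so Borel measurability
  would be too weak.
\<close>

definition strongly_measurable :: "'t measure \<Rightarrow> ('t \<Rightarrow> 'y::real_normed_vector) \<Rightarrow> bool" where
  "strongly_measurable M u \<longleftrightarrow>
     (\<exists>s :: nat \<Rightarrow> 't \<Rightarrow> 'y. (\<forall>n. simple_function M (s n)) \<and>
        (AE t in M. (\<lambda>n. s n t) \<longlonglongrightarrow> u t))"

text \<open>
  The elements of the Lebesgue-Bochner spaces are represented by functions rather than by
  classes modulo null sets.
\<close>

definition L1_space :: "'t measure \<Rightarrow> ('t \<Rightarrow> 'y::real_normed_vector) set" where
  "L1_space M = {u. strongly_measurable M u \<and> (\<integral>\<^sup>+ t. ennreal (norm (u t)) \<partial>M) < \<infinity>}"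

definition Linf_space :: "'t measure \<Rightarrow> ('t \<Rightarrow> 'y::real_normed_vector) set" where
  "Linf_space M = {u. strongly_measurable M u \<and> (\<exists>C. AE t in M. norm (u t) \<le> C)}"

definition Linf_norm :: "'t measure \<Rightarrow> ('t \<Rightarrow> 'y::real_normed_vector) \<Rightarrow> real" where
  "Linf_norm M u = Inf {C. 0 \<le> C \<and> (AE t in M. norm (u t) \<le> C)}"

text \<open>
  Continuous linear functionals on \<open>Linf_space M\<close>; only their values on that set matter.
  Boundedness with respect to the essential supremum makes them respect equality
  almost everywhere.
\<close>

definition Linf_dual :: "'t measure \<Rightarrow> (('t \<Rightarrow> 'y::real_normed_vector) \<Rightarrow> real) set" where
  "Linf_dual M = {\<Lambda>.
     (\<forall>u\<in>Linf_space M. \<forall>w\<in>Linf_space M. \<Lambda> (\<lambda>t. u t + w t) = \<Lambda> u + \<Lambda> w) \<and>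
     (\<forall>c. \<forall>u\<in>Linf_space M. \<Lambda> (\<lambda>t. c *\<^sub>R u t) = c * \<Lambda> u) \<and>
     (\<exists>K. \<forall>u\<in>Linf_space M. \<bar>\<Lambda> u\<bar> \<le> K * Linf_norm M u)}"

definition L1_functional ::
    "'t measure \<Rightarrow> ('t \<Rightarrow> ('x::real_normed_vector \<Rightarrow>\<^sub>L real)) \<Rightarrow> ('t \<Rightarrow> 'x) \<Rightarrow> real" where
  "L1_functional M v = (\<lambda>u. LINT t|M. blinfun_apply (v t) (u t))"

definition Lsing :: "'t measure \<Rightarrow> (('t \<Rightarrow> 'y::real_normed_vector) \<Rightarrow> real) set" where
  "Lsing M = {\<Lambda>\<in>Linf_dual M.
     \<exists>A :: nat \<Rightarrow> 't set. incseq A \<and> range A \<subseteq> sets M \<and> (\<Union>n. A n) = space M \<and>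
       (\<forall>n. \<forall>B\<in>sets M. emeasure M B < \<infinity> \<longrightarrow>
          (\<forall>u\<in>Linf_space M. \<Lambda> (\<lambda>t. indicator (A n \<inter> B) t *\<^sub>R u t) = 0))}"

definition integral_functional ::
    "'t measure \<Rightarrow> ('t \<Rightarrow> 'y \<Rightarrow> ereal) \<Rightarrow> ('t \<Rightarrow> 'y) \<Rightarrow> ereal" where
  "integral_functional M f u = upper_integral M (\<lambda>t. f t (u t))"

text \<open>The effective domain contains the points where the functional equals \<open>-\<infinity>\<close>.\<close>

definition dom_integral_functional ::
    "'t measure \<Rightarrow> ('t \<Rightarrow> 'y::real_normed_vector \<Rightarrow> ereal) \<Rightarrow> ('t \<Rightarrow> 'y) set" where
  "dom_integral_functional M f = {u\<in>Linf_space M. integral_functional M f u < \<infinity>}"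

definition Z_set :: "'t measure \<Rightarrow> real \<Rightarrow> ('t \<Rightarrow> real) set" where
  "Z_set M \<epsilon> = {l. integrable M l \<and> (AE t in M. 0 \<le> l t) \<and> (LINT t|M. l t) \<le> \<epsilon>}"

text \<open>
  In the following notions \<open>Z\<close> is the underlying set of a Banach space and \<open>D\<close> its topological
  dual, as a set of functions. They are used with \<open>Z = UNIV\<close>, \<open>D = Collect bounded_linear\<close>
  and with \<open>Z = Linf_space M\<close>, \<open>D = Linf_dual M\<close>.
\<close>

definition conjugate :: "'z set \<Rightarrow> ('z \<Rightarrow> ereal) \<Rightarrow> ('z \<Rightarrow> real) \<Rightarrow> ereal" where
  "conjugate Z g \<phi> = (SUP z\<in>Z. ereal (\<phi> z) - g z)"

definition indicator_delta :: "'z set \<Rightarrow> 'z \<Rightarrow> ereal" where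
  "indicator_delta C z = (if z \<in> C then 0 else \<infinity>)"

definition support_fun :: "'z set \<Rightarrow> 'z set \<Rightarrow> ('z \<Rightarrow> real) \<Rightarrow> ereal" where
  "support_fun Z C = conjugate Z (indicator_delta C)"

definition eps_subdiff ::
    "'z::minus set \<Rightarrow> ('z \<Rightarrow> real) set \<Rightarrow> real \<Rightarrow> ('z \<Rightarrow> ereal) \<Rightarrow> 'z \<Rightarrow> ('z \<Rightarrow> real) set" where
  "eps_subdiff Z D \<epsilon> g z =
     (if \<bar>g z\<bar> = \<infinity> then {}
      else {\<phi>\<in>D. \<forall>y\<in>Z. ereal (\<phi> (y - z)) \<le> g y - g z + ereal \<epsilon>})"

definition eps_normal ::
    "'z::minus set \<Rightarrow> ('z \<Rightarrow> real) set \<Rightarrow> real \<Rightarrow> 'z set \<Rightarrow> 'z \<Rightarrow> ('z \<Rightarrow> real) set" where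
  "eps_normal Z D \<epsilon> C z = eps_subdiff Z D \<epsilon> (indicator_delta C) z"

definition conjugate_integrand ::
    "('t \<Rightarrow> 'x::real_normed_vector \<Rightarrow> ereal) \<Rightarrow> 't \<Rightarrow> ('x \<Rightarrow>\<^sub>L real) \<Rightarrow> ereal" where
  "conjugate_integrand f t v = conjugate UNIV (f t) (blinfun_apply v)"

end

theory Submission
  imports Defs
begin

text \<open>
  The inequality \<open>\<le>\<close> of the conjugate formula is the Fenchel-Young inequality integrated over \<open>T\<close>:
  for \<open>u\<close> in the domain, the regular part of the functional contributes at most
  \<open>\<I>\<^sub>f\<^sub>*(x\<^sup>*)\<close> and the singular part at most the value of the support function.

  For \<open>\<ge>\<close> the two suprema on the right have to be attained approximately by one and the same bounded
  function. Take \<open>w\<close> in the domain, nearly optimal for the singular part, and \<open>r < \<I>\<^sub>f\<^sub>*(x\<^sup>*)\<close>.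
  Choose an integrable \<open>q\<close> with \<open>q(t) < f\<^sub>t\<^sup>*(x\<^sup>*(t))\<close> and integral above \<open>r\<close>
  (\<open>upper_integral_approx_below\<close>), and a strongly measurable \<open>u\<close> with
  \<open>\<langle>x\<^sup>*(t), u(t)\<rangle> - f\<^sub>t(u(t)) \<ge> q(t)\<close> (\<open>conjugate_selection\<close>). This \<open>u\<close> may be unbounded, so it is used
  only on sets \<open>C\<^sub>n\<close> that increase to \<open>T\<close>, on which it is bounded by \<open>n\<close> and which lie in the sets where the
  singular functional vanishes; off \<open>C\<^sub>n\<close> it is replaced by \<open>w\<close>. The singular functional takes the same value
  on the spliced function as on \<open>w\<close>, while by dominated convergence the regular part exceeds \<open>r\<close> for large \<open>n\<close>
  (\<open>singular_conjugate_approx\<close>).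

  The delicate point is the choice of \<open>u\<close>, because \<open>X\<close> may be nonseparable and selection theorems for
  separable targets do not apply. Here countability comes from \<open>T\<close> instead: up to a null set, \<open>T\<close> is a countable
  union of compact sets on which \<open>t \<mapsto> epi f\<^sub>t\<close> is lower semicontinuous. A compact metric space has a
  countable base, and lower semicontinuity says that a point near \<open>epi f\<^sub>t\<close> stays near \<open>epi f\<^sub>s\<close>
  for all \<open>s\<close> in a basic neighbourhood; so there are countably valued approximate selections, and refining them
  successively gives a uniformly convergent sequence (\<open>lsc_selection\<close>). The dependence of the
  condition on \<open>x\<^sup>*(t)\<close> and \<open>q(t)\<close> is absorbed by covering an open set of pairs by countably many products
  (\<open>uniform_section_cover\<close>), which also yields the measurability of \<open>t \<mapsto> f\<^sub>t(u(t))\<close> and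
  \<open>t \<mapsto> f\<^sub>t\<^sup>*(x\<^sup>*(t))\<close>.

  The description of the \<open>\<epsilon>\<close>-subdifferential follows from the formula. Membership says that the Fenchel gap
  of the functional at \<open>x\<close> is at most \<open>\<epsilon>\<close>, and the formula splits this gap into
  the integral of the pointwise gap \<open>\<ell>(t) = f\<^sub>t(x(t)) + f\<^sub>t\<^sup>*(v\<^sup>*(t)) - \<langle>v\<^sup>*(t), x(t)\<rangle>\<close> and the gap of the singular part.
\<close>

section \<open>Strongly measurable functions\<close>

lemma sets_AE_cong:
  assumes "complete_measure M" "A \<in> sets M" "AE x in M. x \<in> A \<longleftrightarrow> x \<in> B" "B \<subseteq> space M"
  shows "B \<in> sets M"
  using complete_measure.in_sets_AE[OF assms(1) _ assms(2,4)] assms(3) by auto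

lemma measurable_AE_cong:
  assumes "complete_measure M" "f \<in> measurable M N" "AE x in M. f x = g x"
    and "\<And>x. x \<in> space M \<Longrightarrow> g x \<in> space N"
  shows "g \<in> measurable M N"
proof (rule measurableI)
  show "x \<in> space M \<Longrightarrow> g x \<in> space N" for x by fact
  fix A assume A: "A \<in> sets N"
  have "f -` A \<inter> space M \<in> sets M" using assms(2) A by (rule measurable_sets)
  moreover have "AE x in M. x \<in> f -` A \<inter> space M \<longleftrightarrow> x \<in> g -` A \<inter> space M"
    using assms(3) by eventually_elim auto
  ultimately show "g -` A \<inter> space M \<in> sets M"
    by (rule sets_AE_cong[OF assms(1)]) simp
qed

text \<open>
  Together with the next two lemmas, this replaces strong measurability by Borel measurability and
  almost separable range, a condition that passes to countable gluings and to limits.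
\<close>

lemma strongly_measurable_imp_measurable:
  fixes u :: "'t \<Rightarrow> 'y::real_normed_vector"
  assumes "complete_measure M" "strongly_measurable M u"
  shows "u \<in> borel_measurable M"
proof -
  obtain s where s: "\<And>n. simple_function M (s n)" "AE t in M. (\<lambda>n. s n t) \<longlonglongrightarrow> u t"
    using assms(2) unfolding strongly_measurable_def by blast
  from s(2) obtain N where N: "N \<in> null_sets M" "{t \<in> space M. \<not> (\<lambda>n. s n t) \<longlonglongrightarrow> u t} \<subseteq> N"
    by (auto simp: eventually_ae_filter)
  have [measurable]: "s n \<in> borel_measurable M" for n by (rule borel_measurable_simple_function[OF s(1)])
  have [measurable]: "N \<in> sets M" using N by auto
  have "(\<lambda>t. if t \<in> N then 0 else u t) \<in> borel_measurable M"
  proof (rule borel_measurable_LIMSEQ_metric[where f="\<lambda>n t. if t \<in> N then 0 else s n t"])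
    show "(\<lambda>t. if t \<in> N then 0 else s n t) \<in> borel_measurable M" for n by measurable
  next
    fix t assume "t \<in> space M"
    then show "(\<lambda>n. if t \<in> N then 0 else s n t) \<longlonglongrightarrow> (if t \<in> N then 0 else u t)" using N(2) by auto
  qed
  moreover have "AE t in M. (if t \<in> N then 0 else u t) = u t"
    using AE_not_in[OF N(1)] by eventually_elim auto
  ultimately show ?thesis by (rule measurable_AE_cong[OF assms(1)]) simp
qed

lemma strongly_measurable_AE_separable:
  fixes u :: "'t \<Rightarrow> 'y::real_normed_vector"
  assumes "strongly_measurable M u"
  obtains D where "countable D" "AE t in M. u t \<in> closure D"
proof -
  obtain s where s: "\<And>n. simple_function M (s n)" "AE t in M. (\<lambda>n. s n t) \<longlonglongrightarrow> u t"
    using assms unfolding strongly_measurable_def by blast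
  have "countable (\<Union>n. s n ` space M)"
    using s(1) by (auto simp: simple_function_def intro: countable_finite)
  moreover have "AE t in M. u t \<in> closure (\<Union>n. s n ` space M)"
    using s(2) AE_space
  proof eventually_elim
    case (elim t)
    then show ?case unfolding closure_sequential by (intro exI[of _ "\<lambda>n. s n t"]) auto
  qed
  ultimately show thesis using that by blast
qed

text \<open>
  The \<open>n\<close>-th simple function takes at \<open>t\<close> the value nearest to \<open>u t\<close> among the first \<open>n + 1\<close>
  points of the dense sequence.
\<close>

lemma separable_imp_strongly_measurable:
  fixes u :: "'t \<Rightarrow> 'y::real_normed_vector"
  assumes "u \<in> borel_measurable M" and D: "countable D" "AE t in M. u t \<in> closure D"
  shows "strongly_measurable M u"
proof (cases "D = {}")
  case True
  have "AE t in M. (\<lambda>n. 0) \<longlonglongrightarrow> u t" using D(2) by eventually_elim (simp add: True)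
  then show ?thesis unfolding strongly_measurable_def by (intro exI[of _ "\<lambda>n t. 0"]) auto
next
  case False
  define d where "d = from_nat_into D"
  define P where "P n t i \<longleftrightarrow> i \<le> n \<and> (\<forall>j\<le>n. dist (d i) (u t) \<le> dist (d j) (u t))" for n t i
  define k where "k n t = (LEAST i. P n t i)" for n t
  have P: "P n t (k n t)" for n t
  proof -
    have "\<exists>i. is_arg_min (\<lambda>i. dist (d i) (u t)) (\<lambda>i. i \<in> {..n}) i"
      by (rule ex_is_arg_min_if_finite) simp_all
    then obtain i where "is_arg_min (\<lambda>i. dist (d i) (u t)) (\<lambda>i. i \<in> {..n}) i" by blast
    then have "P n t i" by (simp add: P_def is_arg_min_linorder)
    then show ?thesis unfolding k_def by (rule LeastI)
  qed
  have simple: "simple_function M (\<lambda>t. d (k n t))" for n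
  proof (rule simple_function_compose1[where f="k n" and g=d])
    have "k n ` space M \<subseteq> {..n}" using P by (auto simp: P_def)
    moreover
    have "continuous_on UNIV (dist y)" for y :: 'y by (intro continuous_intros)
    then have d_meas: "(\<lambda>t. dist (d i) (u t)) \<in> borel_measurable M" for i
      by (rule measurable_compose[OF assms(1) borel_measurable_continuous_onI])
    define m where "m i t = dist (d i) (u t)" for i t
    have [measurable]: "m i \<in> borel_measurable M" for i
      unfolding m_def by (rule d_meas)
    have "Measurable.pred M (\<lambda>t. P n t i)" for i
      unfolding P_def m_def[symmetric] by measurable
    then have "k n \<in> measurable M (count_space UNIV)"
      unfolding k_def by (rule measurable_Least)
    ultimately show "simple_function M (k n)"
      unfolding simple_function_eq_measurable by (meson finite_atMost finite_subset)
  qed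
  have lim: "(\<lambda>n. d (k n t)) \<longlonglongrightarrow> u t" if cl: "u t \<in> closure D" for t
  proof (rule metric_LIMSEQ_I)
    fix e :: real assume "e > 0"
    then obtain y where "y \<in> D" "dist y (u t) < e" using cl unfolding closure_approachable by blast
    then obtain j where j: "dist (d j) (u t) < e"
      using D(1) False unfolding d_def by (metis from_nat_into_surj)
    have "dist (d (k n t)) (u t) < e" if "n \<ge> j" for n
    proof -
      have "dist (d (k n t)) (u t) \<le> dist (d j) (u t)"
        using P[of n t] that unfolding P_def by blast
      then show ?thesis using j by simp
    qed
    then show "\<exists>no. \<forall>n\<ge>no. dist (d (k n t)) (u t) < e" by blast
  qed
  have "AE t in M. (\<lambda>n. d (k n t)) \<longlonglongrightarrow> u t"
    using D(2) by eventually_elim (rule lim)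
  then show ?thesis
    unfolding strongly_measurable_def using simple by (intro exI[of _ "\<lambda>n t. d (k n t)"]) blast
qed

lemma strongly_measurable_map2:
  fixes h :: "'y::real_normed_vector \<Rightarrow> 'z::real_normed_vector \<Rightarrow> 'w::real_normed_vector"
  assumes "strongly_measurable M u" "strongly_measurable M v"
    and h: "\<And>a b F (c :: nat \<Rightarrow> 'y) d. c \<longlonglongrightarrow> a \<Longrightarrow> d \<longlonglongrightarrow> b \<Longrightarrow> (\<lambda>n. h (c n) (d n)) \<longlonglongrightarrow> h a b"
  shows "strongly_measurable M (\<lambda>t. h (u t) (v t))"
proof -
  obtain s where s: "\<And>n. simple_function M (s n)" "AE t in M. (\<lambda>n. s n t) \<longlonglongrightarrow> u t"
    using assms(1) unfolding strongly_measurable_def by blast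
  obtain r where r: "\<And>n. simple_function M (r n)" "AE t in M. (\<lambda>n. r n t) \<longlonglongrightarrow> v t"
    using assms(2) unfolding strongly_measurable_def by blast
  have "AE t in M. (\<lambda>n. h (s n t) (r n t)) \<longlonglongrightarrow> h (u t) (v t)"
    using s(2) r(2) by eventually_elim (rule h)
  moreover have "simple_function M (\<lambda>t. h (s n t) (r n t))" for n
    by (rule simple_function_compose2[OF s(1) r(1)])
  ultimately show ?thesis
    unfolding strongly_measurable_def by (intro exI[of _ "\<lambda>n t. h (s n t) (r n t)"]) blast
qed

lemma strongly_measurable_real:
  fixes q :: "'t \<Rightarrow> real"
  assumes "q \<in> borel_measurable M"
  shows "strongly_measurable M q"
  by (rule separable_imp_strongly_measurable[OF assms countable_rat]) (simp add: Rats_closure_real)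

lemma strongly_measurable_If:
  assumes "C \<in> sets M" "strongly_measurable M u" "strongly_measurable M w"
  shows "strongly_measurable M (\<lambda>t. if t \<in> C then u t else w t)"
proof -
  obtain s where s: "\<And>n. simple_function M (s n)" "AE t in M. (\<lambda>n. s n t) \<longlonglongrightarrow> u t"
    using assms(2) unfolding strongly_measurable_def by blast
  obtain r where r: "\<And>n. simple_function M (r n)" "AE t in M. (\<lambda>n. r n t) \<longlonglongrightarrow> w t"
    using assms(3) unfolding strongly_measurable_def by blast
  have "simple_function M (\<lambda>t. if t \<in> C then s n t else r n t)" for n
    using assms(1) by (intro simple_function_If_set s(1) r(1)) auto
  moreover have "AE t in M. (\<lambda>n. if t \<in> C then s n t else r n t) \<longlonglongrightarrow> (if t \<in> C then u t else w t)"
    using s(2) r(2) by eventually_elim simp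
  ultimately show ?thesis
    unfolding strongly_measurable_def by (intro exI[of _ "\<lambda>n t. if t \<in> C then s n t else r n t"]) blast
qed

section \<open>Selections of lower semicontinuous multifunctions\<close>

text \<open>
  The base comes from finite nets of a totally bounded set. The ambient space need not have a countable base, so
  the sets are basic only relative to \<open>B\<close>.
\<close>

lemma compact_countable_base:
  fixes B :: "'t::metric_space set"
  assumes "compact B"
  obtains b :: "nat \<Rightarrow> 't set" where "\<And>n. open (b n)"
    and "\<And>t U. t \<in> B \<Longrightarrow> open U \<Longrightarrow> t \<in> U \<Longrightarrow> \<exists>n. t \<in> b n \<and> b n \<inter> B \<subseteq> U"
proof -
  have "\<exists>k. finite k \<and> B \<subseteq> (\<Union>x\<in>k. ball x (1 / real (Suc m)))" for m
    using assms unfolding compact_eq_totally_bounded by (meson of_nat_0_less_iff zero_less_Suc zero_less_divide_1_iff)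
  then obtain K where K: "\<And>m. finite (K m)" "\<And>m. B \<subseteq> (\<Union>x\<in>K m. ball x (1 / real (Suc m)))"
    by metis
  define F where "F = insert {} (\<Union>m. (\<lambda>x. ball x (1 / real (Suc m))) ` K m)"
  have F: "countable F" "F \<noteq> {}"
    unfolding F_def using K(1) by (auto intro!: countable_UN countable_image intro: countable_finite)
  show thesis
  proof
    show "open (from_nat_into F n)" for n
      using from_nat_into[OF F(2), of n] by (auto simp: F_def)
    fix t U assume t: "t \<in> B" "open U" "t \<in> U"
    obtain r where r: "r > 0" "ball t r \<subseteq> U" using t open_contains_ball by blast
    obtain m where m: "1 / real (Suc m) < r / 2" using r nat_approx_posE[of "r/2"] by auto
    obtain x where x: "x \<in> K m" "t \<in> ball x (1 / real (Suc m))" using K(2)[of m] t by blast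
    have "ball x (1 / real (Suc m)) \<subseteq> ball t r"
    proof
      fix s assume "s \<in> ball x (1 / real (Suc m))"
      then show "s \<in> ball t r"
        using x(2) m dist_triangle3[of t s x] by (simp add: dist_commute)
    qed
    moreover have "ball x (1 / real (Suc m)) \<in> F" using x by (auto simp: F_def)
    then obtain n where "from_nat_into F n = ball x (1 / real (Suc m))"
      using F by (metis from_nat_into_surj)
    ultimately show "\<exists>n. t \<in> from_nat_into F n \<and> from_nat_into F n \<inter> B \<subseteq> U"
      using x r by (intro exI[of _ n]) auto
  qed
qed

text \<open>
  The \<open>k\<close>-th approximation \<open>v k\<close> is countably valued and has distance less than \<open>2\<^sup>-\<^sup>k\<close> to \<open>\<Psi> t\<close> at each \<open>t \<in> E\<close>, once \<open>k > 0\<close>.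
  To refine it, pick a point of \<open>\<Psi> t\<close> close to the current value; by lower semicontinuity it
  is within \<open>2\<^sup>-\<^sup>k\<^sup>-\<^sup>1\<close> of \<open>\<Psi> s\<close> for all \<open>s \<in> E\<close> in some basic set \<open>b n\<close> around \<open>t\<close>, so that the new value can be chosen to
  depend only on the old value and on the least suitable \<open>n\<close>. Completeness of \<open>'y\<close> gives the limit.
\<close>

lemma lsc_selection:
  fixes \<Psi> :: "'t::metric_space \<Rightarrow> 'y::banach set"
  assumes borel: "sets borel \<subseteq> sets M" "space M = UNIV" and B: "compact B"
    and E: "E \<in> sets M" "E \<subseteq> B" and lsc: "lsc_multifun_on E \<Psi>" and ne: "\<And>t. t \<in> E \<Longrightarrow> \<Psi> t \<noteq> {}"
  obtains u D where "u \<in> borel_measurable M" "countable D" "\<And>t. u t \<in> closure D"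
    "\<And>t. t \<in> E \<Longrightarrow> u t \<in> closure (\<Psi> t)"
proof -
  obtain b :: "nat \<Rightarrow> 't set" where b: "\<And>n. open (b n)"
    "\<And>t U. t \<in> B \<Longrightarrow> open U \<Longrightarrow> t \<in> U \<Longrightarrow> \<exists>n. t \<in> b n \<and> b n \<inter> B \<subseteq> U"
    using compact_countable_base[OF B] by blast
  \<comment> \<open>\<open>z\<close> is a legitimate new value on \<open>b n\<close> when the old value is \<open>v\<close>; at stage 0 there is none yet.\<close>
  define P where "P k v n z \<longleftrightarrow> (k \<noteq> 0 \<longrightarrow> dist z v < (1/2)^k) \<and>
      (\<forall>s\<in>b n \<inter> E. \<Psi> s \<inter> ball z ((1/2)^Suc k) \<noteq> {})" for k v n and z :: 'y
  \<comment> \<open>Values are coded by the list of the indices \<open>n\<close> chosen so far: lists of naturals form a countable type,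
    so measurability can be checked one code at a time and every \<open>v k\<close> has countable range.\<close>
  define val where "val = rec_list 0 (\<lambda>n c v. SOME z. P (length c) v n z)"
  have val: "val [] = 0" "val (n # c) = (SOME z. P (length c) (val c) n z)" for n c
    by (auto simp: val_def)
  define N where "N c t = (LEAST n. t \<in> b n \<and> (\<exists>z. P (length c) (val c) n z))" for c t
  define C where "C k t = rec_nat [] (\<lambda>_ c. N c t # c) k" for k t
  have C: "C 0 t = []" "C (Suc k) t = N (C k t) t # C k t" for k t
    by (auto simp: C_def)
  have len: "length (C k t) = k" for k t by (induction k) (auto simp: C)
  have [measurable]: "b n \<in> sets M" for n using b(1)[of n] borel by auto
  have N_meas: "N c \<in> measurable M (count_space UNIV)" for c unfolding N_def by measurable
  have C_meas[measurable]: "C k \<in> measurable M (count_space UNIV)" for k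
  proof (induction k)
    case 0 show ?case by (simp add: C)
  next
    case (Suc k)
    have 1: "(\<lambda>t. N (C k t) t) \<in> measurable M (count_space UNIV)"
      by (rule measurable_compose_countable[OF N_meas Suc])
    show ?case unfolding C
    proof (rule measurable_compose_countable[OF _ 1])
      show "(\<lambda>t. i # C k t) \<in> measurable M (count_space UNIV)" for i
        by (rule measurable_compose[OF Suc]) simp
    qed
  qed
  define v where "v k t = val (C k t)" for k t
  have v_meas: "v k \<in> borel_measurable M" for k
    unfolding v_def by (rule measurable_compose[OF C_meas]) simp
  have step: "(k \<noteq> 0 \<longrightarrow> dist (v (Suc k) t) (v k t) < (1/2)^k) \<and> \<Psi> t \<inter> ball (v (Suc k) t) ((1/2)^Suc k) \<noteq> {}"
    if t: "t \<in> E" and IH: "k \<noteq> 0 \<longrightarrow> \<Psi> t \<inter> ball (v k t) ((1/2)^k) \<noteq> {}" for k t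
  proof -
    obtain w where w: "w \<in> \<Psi> t" "k \<noteq> 0 \<longrightarrow> dist w (v k t) < (1/2)^k"
      using IH ne[OF t] by (cases "k = 0") (auto simp: dist_commute)
    have "open (ball w ((1/2)^Suc k))" "\<Psi> t \<inter> ball w ((1/2)^Suc k) \<noteq> {}" using w by auto
    then obtain U where U: "open U" "t \<in> U" "\<forall>s\<in>U \<inter> E. \<Psi> s \<inter> ball w ((1/2)^Suc k) \<noteq> {}"
      using lsc t ne[OF t] unfolding lsc_multifun_on_def lsc_multifun_at_def by meson
    obtain n where n: "t \<in> b n" "b n \<inter> B \<subseteq> U" using b(2) t E U by blast
    have "P k (v k t) n w" unfolding P_def using w U(3) n(2) E(2) by blast
    then have "t \<in> b n \<and> (\<exists>z. P (length (C k t)) (val (C k t)) n z)"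
      using n by (auto simp: len v_def)
    then have "t \<in> b (N (C k t) t) \<and> (\<exists>z. P (length (C k t)) (val (C k t)) (N (C k t) t) z)"
      unfolding N_def by (rule LeastI)
    then have 1: "t \<in> b (N (C k t) t)" and "\<exists>z. P k (v k t) (N (C k t) t) z"
      by (auto simp: len v_def)
    then have "P k (v k t) (N (C k t) t) (v (Suc k) t)"
      unfolding v_def C val len by (meson someI_ex)
    then show ?thesis using 1 t unfolding P_def by blast
  qed
  have inv: "k \<noteq> 0 \<longrightarrow> \<Psi> t \<inter> ball (v k t) ((1/2)^k) \<noteq> {}" if "t \<in> E" for k t
    using step[OF that] by (induction k) auto
  have cau: "dist (v (Suc (Suc k)) t) (v (Suc k) t) < (1/2)^Suc k" if "t \<in> E" for k t
    using step[OF that inv[OF that], of "Suc k"] by blast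
  have conv: "convergent (\<lambda>k. v (Suc k) t)" if "t \<in> E" for t
  proof (rule Cauchy_convergent)
    have "summable (\<lambda>k. v (Suc (Suc k)) t - v (Suc k) t)"
    proof (rule summable_comparison_test')
      show "summable (\<lambda>k. (1/2::real)^Suc k)" by (simp add: summable_geometric summable_mult)
      show "norm (v (Suc (Suc k)) t - v (Suc k) t) \<le> (1/2)^Suc k" if "k \<ge> 0" for k
        using cau[OF \<open>t \<in> E\<close>, of k] by (simp add: dist_norm)
    qed
    from summable_LIMSEQ[OF this]
    have "(\<lambda>n. v (Suc n) t - v (Suc 0) t) \<longlonglongrightarrow> (\<Sum>k. v (Suc (Suc k)) t - v (Suc k) t)"
      by (simp only: sum_lessThan_telescope[where f="\<lambda>k. v (Suc k) t"])
    from tendsto_add[OF this tendsto_const[of "v (Suc 0) t"]]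
    show "Cauchy (\<lambda>k. v (Suc k) t)" by (intro LIMSEQ_imp_Cauchy) simp
  qed
  define u where "u t = (if t \<in> E then lim (\<lambda>k. v (Suc k) t) else 0)" for t
  have lim: "(\<lambda>k. v (Suc k) t) \<longlonglongrightarrow> u t" if "t \<in> E" for t
    using conv[OF that] that by (simp add: u_def convergent_LIMSEQ_iff)
  show thesis
  proof
    show "u \<in> borel_measurable M"
    proof (rule borel_measurable_LIMSEQ_metric[where f="\<lambda>k t. if t \<in> E then v (Suc k) t else 0"])
      show "(\<lambda>t. if t \<in> E then v (Suc k) t else 0) \<in> borel_measurable M" for k
        using v_meas[of "Suc k"] E(1) by measurable
      show "(\<lambda>k. if t \<in> E then v (Suc k) t else 0) \<longlonglongrightarrow> u t" for t
        using lim by (cases "t \<in> E") (auto simp: u_def)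
    qed
    show "countable (range val)" by simp
    show "u t \<in> closure (range val)" for t
    proof (cases "t \<in> E")
      case True
      show ?thesis unfolding closure_sequential
        using lim[OF True] by (intro exI[of _ "\<lambda>k. v (Suc k) t"]) (auto simp: v_def)
    next
      case False
      then have "u t = val []" by (simp add: u_def val)
      then show ?thesis using subsetD[OF closure_subset, of "val []" "range val"] by simp
    qed
    show "u t \<in> closure (\<Psi> t)" if t: "t \<in> E" for t
    proof -
      have "\<exists>w. w \<in> \<Psi> t \<and> dist w (v (Suc k) t) < (1/2)^Suc k" for k
        using inv[OF t, of "Suc k"] by (auto simp: dist_commute)
      then obtain w where w: "\<And>k. w k \<in> \<Psi> t" "\<And>k. dist (w k) (v (Suc k) t) < (1/2)^Suc k" by metis
      have "(\<lambda>k. (1/2::real)^Suc k) \<longlonglongrightarrow> 0" by (intro LIMSEQ_Suc LIMSEQ_power_zero) simp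
      moreover have "norm (w k - v (Suc k) t) \<le> (1/2)^Suc k" for k
        using w(2)[of k] unfolding dist_norm by (rule less_imp_le)
      then have "\<forall>\<^sub>F k in sequentially. norm (w k - v (Suc k) t) \<le> (1/2)^Suc k"
        by (intro always_eventually allI)
      ultimately have "(\<lambda>k. w k - v (Suc k) t) \<longlonglongrightarrow> 0"
        by (rule Lim_null_comparison[rotated])
      with lim[OF t] have "w \<longlonglongrightarrow> u t" by (rule Lim_transform)
      with w(1) show ?thesis unfolding closure_sequential by (intro exI[of _ w]) auto
    qed
  qed
qed

section \<open>Multifunctions that are lower semicontinuous on large compact sets\<close>

definition Lusin_lsc :: "'t::metric_space measure \<Rightarrow> ('t \<Rightarrow> 'y::topological_space set) \<Rightarrow> bool" where
  "Lusin_lsc M \<Phi> \<longleftrightarrow>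
     (\<forall>\<epsilon>::real. 0 < \<epsilon> \<longrightarrow> (\<forall>A\<in>sets M. emeasure M A < \<infinity> \<longrightarrow>
        (\<exists>B. compact B \<and> B \<subseteq> A \<and> emeasure M (A - B) < ennreal \<epsilon> \<and> lsc_multifun_on B \<Phi>)))"

lemma lsc_multifun_onD:
  assumes "lsc_multifun_on B \<Phi>" "t \<in> B" "open V" "\<Phi> t \<inter> V \<noteq> {}"
  obtains U where "open U" "t \<in> U" "\<And>s. s \<in> U \<Longrightarrow> s \<in> B \<Longrightarrow> \<Phi> s \<inter> V \<noteq> {}"
proof -
  have "\<Phi> t \<noteq> {}" using assms(4) by blast
  then have "\<exists>U. open U \<and> t \<in> U \<and> (\<forall>s\<in>U \<inter> B. \<Phi> s \<inter> V \<noteq> {})"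
    using assms unfolding lsc_multifun_on_def lsc_multifun_at_def by simp
  then show thesis using that by blast
qed

text \<open>
  An open set that meets the closure of \<open>epi (inf F\<^sub>i)\<close> contains a point strictly above the graph of the infimum,
  hence a point of some \<open>epi F\<^sub>i\<close>. So lower semicontinuity passes from the members of the family to \<open>f\<close>, and
  on the same compact set, since the family is uniform.
\<close>

lemma admissible_integrand_epi:
  fixes M :: "'t::metric_space measure" and f :: "'t \<Rightarrow> 'x::real_normed_vector \<Rightarrow> ereal"
  assumes "admissible_integrand M f"
  shows "Lusin_lsc M (\<lambda>t. epi (f t))" and "closed (epi (f t))"
proof -
  obtain I and F :: "('t \<Rightarrow> 'x \<Rightarrow> ereal) \<Rightarrow> 't \<Rightarrow> 'x \<Rightarrow> ereal"
    where F: "uniform_Lusin_family M I F"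
      and f: "\<And>t. epi (f t) = closure (epi (\<lambda>x. INF i\<in>I. F i t x))"
    using assms unfolding admissible_integrand_def by blast
  show "closed (epi (f t))" by (simp add: f)
  have lsc: "lsc_multifun_on B (\<lambda>t. epi (f t))" if B: "\<forall>i\<in>I. lsc_multifun_on B (\<lambda>t. epi (F i t))" for B
    unfolding lsc_multifun_on_def lsc_multifun_at_def
  proof (intro ballI impI allI)
    fix t V assume t: "t \<in> B" and V: "open V \<and> epi (f t) \<inter> V \<noteq> {}"
    have "epi (\<lambda>x. INF i\<in>I. F i t x) \<inter> V \<noteq> {}"
      using V f[of t] open_Int_closure_eq_empty[of V] by (auto simp: Int_commute)
    then obtain x \<alpha> where x: "(INF i\<in>I. F i t x) \<le> ereal \<alpha>" "(x, \<alpha>) \<in> V" by (auto simp: epi_def)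
    \<comment> \<open>The infimum need not be attained at height \<open>\<alpha>\<close>; raising the height a little inside \<open>V\<close> makes room.\<close>
    obtain e where e: "e > 0" "ball (x, \<alpha>) e \<subseteq> V" using V x(2) open_contains_ball by blast
    have "dist (x, \<alpha>) (x, \<alpha> + e / 2) = e / 2" using e(1) by (simp add: dist_Pair_Pair dist_real_def)
    then have mem: "(x, \<alpha> + e / 2) \<in> V" using e by (auto simp: subset_iff)
    have "(INF i\<in>I. F i t x) < ereal (\<alpha> + e / 2)" using x(1) e(1) by (auto intro: le_less_trans)
    then obtain i where i: "i \<in> I" "F i t x < ereal (\<alpha> + e / 2)" by (auto simp: INF_less_iff)
    then have "epi (F i t) \<inter> V \<noteq> {}" using mem by (auto simp: epi_def intro: less_imp_le)
    then obtain U where U: "open U" "t \<in> U" "\<And>s. s \<in> U \<Longrightarrow> s \<in> B \<Longrightarrow> epi (F i s) \<inter> V \<noteq> {}"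
      using lsc_multifun_onD[of B "\<lambda>t. epi (F i t)" t V] B i(1) t V by blast
    have "epi (F i s) \<subseteq> epi (f s)" for s
    proof -
      have "epi (F i s) \<subseteq> epi (\<lambda>x. INF i\<in>I. F i s x)"
        using i(1) by (auto simp: epi_def intro: INF_lower2)
      then show ?thesis using closure_subset unfolding f by blast
    qed
    then show "\<exists>U. open U \<and> t \<in> U \<and> (\<forall>s\<in>U \<inter> B. epi (f s) \<inter> V \<noteq> {})"
      using U by (intro exI[of _ U]) blast
  qed
  show "Lusin_lsc M (\<lambda>t. epi (f t))"
    unfolding Lusin_lsc_def
  proof (intro allI impI ballI)
    fix \<epsilon> :: real and A assume "0 < \<epsilon>" "A \<in> sets M" "emeasure M A < \<infinity>"
    then obtain B where "compact B" "B \<subseteq> A" "emeasure M (A - B) < ennreal \<epsilon>"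
        "\<forall>i\<in>I. lsc_multifun_on B (\<lambda>t. epi (F i t))"
      using F unfolding uniform_Lusin_family_def by meson
    then show "\<exists>B. compact B \<and> B \<subseteq> A \<and> emeasure M (A - B) < ennreal \<epsilon> \<and> lsc_multifun_on B (\<lambda>t. epi (f t))"
      using lsc by blast
  qed
qed

locale complete_borel_measure = complete_measure M + sigma_finite_measure M
    for M :: "'t::metric_space measure" +
  assumes space_UNIV: "space M = UNIV" and borel_sets: "sets borel \<subseteq> sets M"
begin

lemma compact_in_sets: "compact B \<Longrightarrow> B \<in> sets M"
  using borel_sets borel_compact by blast

lemma open_in_sets: "open B \<Longrightarrow> B \<in> sets M"
  using borel_sets by auto

lemma complete: "complete_measure M"
  by unfold_locales

lemma Lusin_lsc_cover:
  assumes "Lusin_lsc M \<Phi>"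
  obtains B :: "nat \<Rightarrow> 't set" where "\<And>k. compact (B k)" "\<And>k. lsc_multifun_on (B k) \<Phi>"
    "AE t in M. \<exists>k. t \<in> B k"
proof -
  obtain A :: "nat \<Rightarrow> 't set" where A: "range A \<subseteq> sets M" "(\<Union>i. A i) = space M" "\<And>i. emeasure M (A i) \<noteq> \<infinity>"
    using sigma_finite_incseq by metis
  have "\<exists>B. compact B \<and> B \<subseteq> A n \<and> emeasure M (A n - B) < ennreal (1 / real (Suc m)) \<and> lsc_multifun_on B \<Phi>" for n m
  proof -
    have "A n \<in> sets M" "emeasure M (A n) < \<infinity>" using A(1) A(3)[of n] by (auto simp: top.not_eq_extremum)
    moreover have "0 < 1 / real (Suc m)" by simp
    ultimately show ?thesis using assms unfolding Lusin_lsc_def by meson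
  qed
  then obtain B where B: "\<And>n m. compact (B n m)" "\<And>n m. B n m \<subseteq> A n"
    "\<And>n m. emeasure M (A n - B n m) < ennreal (1 / real (Suc m))" "\<And>n m. lsc_multifun_on (B n m) \<Phi>"
    by metis
  have [measurable]: "A n \<in> sets M" "B n m \<in> sets M" for n m
    using A(1) compact_in_sets[OF B(1)] by auto
  have null: "A n - (\<Union>m. B n m) \<in> null_sets M" for n
  proof (rule null_setsI)
    show "A n - (\<Union>m. B n m) \<in> sets M" by measurable
    have "emeasure M (A n - (\<Union>m. B n m)) \<le> ennreal (1 / real (Suc m))" for m
    proof -
      have "emeasure M (A n - (\<Union>m. B n m)) \<le> emeasure M (A n - B n m)"
        by (rule emeasure_mono) auto
      also have "\<dots> \<le> ennreal (1 / real (Suc m))" using B(3) by (rule less_imp_le)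
      finally show ?thesis .
    qed
    moreover have "(\<lambda>m. ennreal (1 / real (Suc m))) \<longlonglongrightarrow> ennreal 0"
      by (intro tendsto_ennrealI LIMSEQ_inverse_real_of_nat[unfolded inverse_eq_divide])
    ultimately have "emeasure M (A n - (\<Union>m. B n m)) \<le> ennreal 0"
      by (intro tendsto_lowerbound[where F=sequentially]) auto
    then show "emeasure M (A n - (\<Union>m. B n m)) = 0" by simp
  qed
  have "AE t in M. \<forall>n. t \<notin> A n - (\<Union>m. B n m)"
    unfolding AE_all_countable using AE_not_in[OF null] by blast
  then have "AE t in M. \<exists>n m. t \<in> B n m"
  proof eventually_elim
    case (elim t)
    have "t \<in> (\<Union>n. A n)" using A(2) space_UNIV by simp
    with elim show ?case by blast
  qed
  then have "AE t in M. \<exists>k. t \<in> (case prod_decode k of (n, m) \<Rightarrow> B n m)"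
  proof eventually_elim
    case (elim t)
    then obtain n m where "t \<in> B n m" by blast
    then show ?case by (intro exI[of _ "prod_encode (n, m)"]) simp
  qed
  then show thesis using B(1,4) that[of "\<lambda>k. case prod_decode k of (n, m) \<Rightarrow> B n m"]
    by (simp split: prod.split)
qed

text \<open>
  On each compact set of the cover the set in question is relatively open, hence Borel; completeness of the
  measure takes care of the null set that the cover misses.
\<close>

lemma hits_open_in_sets:
  assumes "Lusin_lsc M \<Phi>" "open V"
  shows "{t. \<Phi> t \<inter> V \<noteq> {}} \<in> sets M"
proof -
  obtain B :: "nat \<Rightarrow> 't set" where B: "\<And>k. compact (B k)" "\<And>k. lsc_multifun_on (B k) \<Phi>"
    "AE t in M. \<exists>k. t \<in> B k"
    using Lusin_lsc_cover[OF assms(1)] by metis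
  have "{t \<in> B k. \<Phi> t \<inter> V \<noteq> {}} \<in> sets M" for k
  proof -
    define G where "G = \<Union>{U. open U \<and> U \<inter> B k \<subseteq> {t. \<Phi> t \<inter> V \<noteq> {}}}"
    have "{t \<in> B k. \<Phi> t \<inter> V \<noteq> {}} = G \<inter> B k"
    proof (intro equalityI subsetI)
      fix t assume t: "t \<in> {t \<in> B k. \<Phi> t \<inter> V \<noteq> {}}"
      then obtain U where "open U" "t \<in> U" "\<And>s. s \<in> U \<Longrightarrow> s \<in> B k \<Longrightarrow> \<Phi> s \<inter> V \<noteq> {}"
        using lsc_multifun_onD[OF B(2) _ assms(2)] by blast
      then show "t \<in> G \<inter> B k" using t unfolding G_def by blast
    qed (auto simp: G_def)
    moreover have "open G" by (auto simp: G_def)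
    ultimately show ?thesis using open_in_sets compact_in_sets[OF B(1)] by auto
  qed
  then have "(\<Union>k. {t \<in> B k. \<Phi> t \<inter> V \<noteq> {}}) \<in> sets M" by blast
  then show ?thesis
    by (rule sets_AE_cong[OF complete]) (use B(3) in eventually_elim, auto simp: space_UNIV)
qed

end

section \<open>Open conditions that depend on a parameter\<close>

text \<open>
  The points \<open>z\<close> for which \<open>(\<theta>, z) \<in> W\<close> holds for all \<open>\<theta>\<close> close to \<open>d\<close>, robustly in \<open>z\<close>. With \<open>d\<close> in a countable dense set
  and \<open>m\<close> a natural number, countably many such open sets exhaust all sections of \<open>W\<close>, although the space
  of the \<open>z\<close> may be nonseparable.
\<close>

definition uniform_section :: "('p::metric_space \<times> 'y::topological_space) set \<Rightarrow> 'p \<Rightarrow> nat \<Rightarrow> 'y set" where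
  "uniform_section W d m = interior {z. \<forall>\<theta>\<in>ball d (1 / real (Suc m)). (\<theta>, z) \<in> W}"

lemma open_uniform_section: "open (uniform_section W d m)"
  by (simp add: uniform_section_def)

lemma uniform_sectionD:
  assumes "z \<in> uniform_section W d m" "dist d \<theta> < 1 / real (Suc m)"
  shows "(\<theta>, z) \<in> W"
  using assms interior_subset unfolding uniform_section_def by fastforce

lemma uniform_section_cover:
  fixes W :: "('p::metric_space \<times> 'y::metric_space) set"
  assumes "open W" "\<theta> \<in> closure D" "(\<theta>, z) \<in> W"
  obtains d m where "d \<in> D" "dist d \<theta> < 1 / real (Suc m)" "z \<in> uniform_section W d m"
proof -
  obtain P Q where PQ: "open P" "open Q" "(\<theta>, z) \<in> P \<times> Q" "P \<times> Q \<subseteq> W"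
    using open_prod_elim[OF assms(1,3)] by blast
  obtain r where r: "r > 0" "ball \<theta> r \<subseteq> P" using PQ open_contains_ball by blast
  obtain m where m: "1 / real (Suc m) < r / 2" using r nat_approx_posE[of "r/2"] by auto
  have "1 / real (Suc m) > 0" by simp
  then obtain d where d: "d \<in> D" "dist d \<theta> < 1 / real (Suc m)"
    using assms(2) unfolding closure_approachable by blast
  have "\<theta>' \<in> P" if "\<theta>' \<in> ball d (1 / real (Suc m))" for \<theta>'
  proof -
    have "dist \<theta> \<theta>' < r" using that d(2) m dist_triangle3[of \<theta> \<theta>' d] by (simp add: dist_commute)
    then show ?thesis using r by auto
  qed
  then have "Q \<subseteq> {z. \<forall>\<theta>\<in>ball d (1 / real (Suc m)). (\<theta>, z) \<in> W}" using PQ by blast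
  then have "z \<in> uniform_section W d m"
    using PQ unfolding uniform_section_def by (intro interiorI[of Q]) auto
  with d show thesis using that by blast
qed

context complete_borel_measure
begin

lemma hits_moving_open_in_sets:
  fixes \<Phi> :: "'t \<Rightarrow> 'y::metric_space set" and \<theta> :: "'t \<Rightarrow> 'p::real_normed_vector"
  assumes "Lusin_lsc M \<Phi>" "strongly_measurable M \<theta>" "open W"
  shows "{t. \<exists>z\<in>\<Phi> t. (\<theta> t, z) \<in> W} \<in> sets M"
proof -
  obtain D where D: "countable D" "AE t in M. \<theta> t \<in> closure D"
    using strongly_measurable_AE_separable[OF assms(2)] by blast
  have ball: "\<theta> -` ball d r \<in> sets M" for d r
    using measurable_sets[OF strongly_measurable_imp_measurable[OF complete assms(2)], of "ball d r"]
    by (simp add: space_UNIV)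
  have "(\<Union>d\<in>D. \<Union>m. \<theta> -` ball d (1 / real (Suc m)) \<inter> {t. \<Phi> t \<inter> uniform_section W d m \<noteq> {}}) \<in> sets M"
    using D(1) ball hits_open_in_sets[OF assms(1) open_uniform_section]
    by (intro sets.countable_UN'' sets.Int) auto
  then show ?thesis
  proof (rule sets_AE_cong[OF complete])
    show "AE t in M. (t \<in> (\<Union>d\<in>D. \<Union>m. \<theta> -` ball d (1 / real (Suc m)) \<inter> {t. \<Phi> t \<inter> uniform_section W d m \<noteq> {}}))
        \<longleftrightarrow> t \<in> {t. \<exists>z\<in>\<Phi> t. (\<theta> t, z) \<in> W}"
      using D(2)
    proof eventually_elim
      case (elim t)
      show ?case
      proof
        assume "t \<in> {t. \<exists>z\<in>\<Phi> t. (\<theta> t, z) \<in> W}"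
        then obtain z where z: "z \<in> \<Phi> t" "(\<theta> t, z) \<in> W" by blast
        then obtain d m where "d \<in> D" "dist d (\<theta> t) < 1 / real (Suc m)" "z \<in> uniform_section W d m"
          using uniform_section_cover[OF assms(3) elim] by metis
        then show "t \<in> (\<Union>d\<in>D. \<Union>m. \<theta> -` ball d (1 / real (Suc m)) \<inter> {t. \<Phi> t \<inter> uniform_section W d m \<noteq> {}})"
          using z by auto
      qed (auto dest: uniform_sectionD)
    qed
  qed (simp add: space_UNIV)
qed

text \<open>
  On the set of those \<open>t\<close> in one compact set of the cover where \<open>\<theta> t\<close> is close to \<open>d\<close> and \<open>\<Phi> t\<close> meets \<open>uniform_section W d m\<close>,
  the selection can be made from \<open>\<Phi> t \<inter> uniform_section W d m\<close>, which is lower semicontinuous because the second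
  set is open and fixed. Countably many such sets cover almost everything, and the selections are glued. Limits of
  approximate selections stay only in the closure of \<open>W\<close>.
\<close>

lemma moving_open_selection:
  fixes \<Phi> :: "'t \<Rightarrow> 'y::banach set" and \<theta> :: "'t \<Rightarrow> 'p::real_normed_vector"
  assumes "Lusin_lsc M \<Phi>" and closed: "\<And>t. closed (\<Phi> t)" and "strongly_measurable M \<theta>" "open W"
    and ne: "AE t in M. \<exists>z\<in>\<Phi> t. (\<theta> t, z) \<in> W"
  obtains \<sigma> where "strongly_measurable M \<sigma>" "AE t in M. \<sigma> t \<in> \<Phi> t \<and> (\<theta> t, \<sigma> t) \<in> closure W"
proof -
  obtain B :: "nat \<Rightarrow> 't set" where B: "\<And>k. compact (B k)" "\<And>k. lsc_multifun_on (B k) \<Phi>"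
    "AE t in M. \<exists>k. t \<in> B k"
    using Lusin_lsc_cover[OF assms(1)] by metis
  obtain D where D: "countable D" "AE t in M. \<theta> t \<in> closure D"
    using strongly_measurable_AE_separable[OF assms(3)] by blast
  have ball: "\<theta> -` ball d r \<in> sets M" for d r
    using measurable_sets[OF strongly_measurable_imp_measurable[OF complete assms(3)], of "ball d r"]
    by (simp add: space_UNIV)
  define E where "E = (\<lambda>(k, i, m). let d = from_nat_into D i in
     B k \<inter> \<theta> -` ball d (1 / real (Suc m)) \<inter> {t. \<Phi> t \<inter> uniform_section W d m \<noteq> {}})"
  have E_sets: "E j \<in> sets M" for j
    unfolding E_def Let_def
    using ball hits_open_in_sets[OF assms(1) open_uniform_section] compact_in_sets[OF B(1)]
    by (auto split: prod.split intro!: sets.Int)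
  have "\<exists>u C. u \<in> borel_measurable M \<and> countable C \<and> (\<forall>t. u t \<in> closure C) \<and>
      (\<forall>t\<in>E j. u t \<in> \<Phi> t \<and> (\<theta> t, u t) \<in> closure W)" for j
  proof -
    obtain k i m where j: "j = (k, i, m)" by (cases j) auto
    define V where "V = uniform_section W (from_nat_into D i) m"
    have E: "E j = B k \<inter> \<theta> -` ball (from_nat_into D i) (1 / real (Suc m)) \<inter> {t. \<Phi> t \<inter> V \<noteq> {}}"
      by (simp add: E_def j V_def Let_def)
    have "lsc_multifun_on (E j) (\<lambda>t. \<Phi> t \<inter> V)"
      unfolding lsc_multifun_on_def lsc_multifun_at_def
    proof (intro ballI impI allI)
      fix t V' assume t: "t \<in> E j" and V': "open V' \<and> \<Phi> t \<inter> V \<inter> V' \<noteq> {}"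
      have "open (V \<inter> V')" using V' by (simp add: V_def open_uniform_section open_Int)
      moreover have "\<Phi> t \<inter> (V \<inter> V') \<noteq> {}" using V' by (simp add: Int_assoc)
      ultimately obtain U where "open U" "t \<in> U" "\<And>s. s \<in> U \<Longrightarrow> s \<in> B k \<Longrightarrow> \<Phi> s \<inter> (V \<inter> V') \<noteq> {}"
        using lsc_multifun_onD[OF B(2)[of k], of t] t unfolding E by blast
      then show "\<exists>U. open U \<and> t \<in> U \<and> (\<forall>s\<in>U \<inter> E j. \<Phi> s \<inter> V \<inter> V' \<noteq> {})"
        unfolding E by (intro exI[of _ U]) (simp add: Int_assoc)
    qed
    moreover have "E j \<subseteq> B k" "\<And>t. t \<in> E j \<Longrightarrow> \<Phi> t \<inter> V \<noteq> {}" by (auto simp: E)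
    ultimately obtain u C where u: "u \<in> borel_measurable M" "countable C" "\<And>t. u t \<in> closure C"
        "\<And>t. t \<in> E j \<Longrightarrow> u t \<in> closure (\<Phi> t \<inter> V)"
      using lsc_selection[OF borel_sets space_UNIV B(1)[of k] E_sets[of j], of "\<lambda>t. \<Phi> t \<inter> V"] by blast
    have "u t \<in> \<Phi> t \<and> (\<theta> t, u t) \<in> closure W" if t: "t \<in> E j" for t
    proof
      have "closure (\<Phi> t \<inter> V) \<subseteq> \<Phi> t" using closed[of t] by (intro closure_minimal) auto
      then show "u t \<in> \<Phi> t" using u(4)[OF t] by blast
      have "(\<theta> t, z) \<in> W" if "z \<in> V" for z
        using that t uniform_sectionD[of z W "from_nat_into D i" m "\<theta> t"] unfolding V_def E by auto
      then have "{\<theta> t} \<times> (\<Phi> t \<inter> V) \<subseteq> W" by auto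
      then have "closure ({\<theta> t} \<times> (\<Phi> t \<inter> V)) \<subseteq> closure W" by (rule closure_mono)
      then show "(\<theta> t, u t) \<in> closure W" using u(4)[OF t] unfolding closure_Times by auto
    qed
    then show ?thesis using u by blast
  qed
  then obtain u C where u: "\<And>j. u j \<in> borel_measurable M" "\<And>j. countable (C j)" "\<And>j t. u j t \<in> closure (C j)"
      "\<And>j t. t \<in> E j \<Longrightarrow> u j t \<in> \<Phi> t \<and> (\<theta> t, u j t) \<in> closure W"
    by metis
  define N where "N t = (LEAST n. t \<in> E (from_nat n))" for t
  define \<sigma> where "\<sigma> t = u (from_nat (N t)) t" for t
  have "N \<in> measurable M (count_space UNIV)"
    unfolding N_def using E_sets by (intro measurable_Least) (simp add: pred_def space_UNIV)
  then have "\<sigma> \<in> borel_measurable M"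
    unfolding \<sigma>_def by (rule measurable_compose_countable[OF u(1)])
  moreover have "countable (\<Union>j. C j)" using u(2) by blast
  moreover have "AE t in M. \<sigma> t \<in> closure (\<Union>j. C j)"
  proof (rule AE_I2)
    show "\<sigma> t \<in> closure (\<Union>j. C j)" for t
      unfolding \<sigma>_def by (rule subsetD[OF closure_mono u(3)]) blast
  qed
  ultimately have "strongly_measurable M \<sigma>" by (rule separable_imp_strongly_measurable)
  moreover have "AE t in M. \<sigma> t \<in> \<Phi> t \<and> (\<theta> t, \<sigma> t) \<in> closure W"
    using B(3) D(2) ne
  proof eventually_elim
    case (elim t)
    obtain k where k: "t \<in> B k" using elim by blast
    obtain z where z: "z \<in> \<Phi> t" "(\<theta> t, z) \<in> W" using elim by blast
    obtain d m where d: "d \<in> D" "dist d (\<theta> t) < 1 / real (Suc m)" "z \<in> uniform_section W d m"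
      using uniform_section_cover[OF assms(4) elim(2) z(2)] by metis
    obtain i where i: "from_nat_into D i = d" using D(1) d(1) by (metis from_nat_into_surj)
    have "t \<in> E (k, i, m)" using k z d i by (auto simp: E_def Let_def)
    then have "t \<in> E (from_nat (to_nat (k, i, m)))" by simp
    then have "t \<in> E (from_nat (N t))" unfolding N_def by (rule LeastI)
    then show ?case unfolding \<sigma>_def by (rule u(4))
  qed
  ultimately show thesis using that by blast
qed

end

section \<open>Integrands and their conjugates along measurable functions\<close>

context complete_borel_measure
begin

text \<open>
  As the epigraph is closed, \<open>f\<^sub>t(u(t)) \<le> a\<close> holds iff the epigraph meets every ball around \<open>(u(t), a)\<close>, which is an open
  condition with parameter \<open>u(t)\<close>.
\<close>

lemma composition_measurable:
  fixes f :: "'t \<Rightarrow> 'x::real_normed_vector \<Rightarrow> ereal"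
  assumes "Lusin_lsc M (\<lambda>t. epi (f t))" and closed: "\<And>t. closed (epi (f t))" and u: "strongly_measurable M u"
  shows "(\<lambda>t. f t (u t)) \<in> borel_measurable M"
proof -
  have real: "{t. f t (u t) \<le> ereal a} \<in> sets M" for a
  proof -
    define W where "W n = {p::'x \<times> ('x \<times> real). dist (fst p, a) (snd p) < 1 / real (Suc n)}" for n
    have "open (W n)" for n
      unfolding W_def by (intro open_Collect_less continuous_intros)
    then have "(\<Inter>n. {t. \<exists>z\<in>epi (f t). (u t, z) \<in> W n}) \<in> sets M"
      using hits_moving_open_in_sets[OF assms(1) u] by blast
    moreover have "(\<Inter>n. {t. \<exists>z\<in>epi (f t). (u t, z) \<in> W n}) = {t. f t (u t) \<le> ereal a}"
    proof (intro equalityI subsetI)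
      fix t assume t: "t \<in> (\<Inter>n. {t. \<exists>z\<in>epi (f t). (u t, z) \<in> W n})"
      have "(u t, a) \<in> closure (epi (f t))"
        unfolding closure_approachable
      proof (intro allI impI)
        fix e :: real assume "0 < e"
        then obtain n where n: "1 / real (Suc n) < e" using nat_approx_posE by auto
        from t have "\<exists>z\<in>epi (f t). (u t, z) \<in> W n" by blast
        then obtain z where z: "z \<in> epi (f t)" "dist (u t, a) z < 1 / real (Suc n)"
          unfolding W_def fst_conv snd_conv mem_Collect_eq by blast
        have "dist z (u t, a) < e" using z(2) n by (simp only: dist_commute[of z])
        then show "\<exists>z\<in>epi (f t). dist z (u t, a) < e" using z(1) by blast
      qed
      then show "t \<in> {t. f t (u t) \<le> ereal a}" using closed[of t] by (simp add: epi_def)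
    next
      fix t assume "t \<in> {t. f t (u t) \<le> ereal a}"
      then have "(u t, a) \<in> epi (f t)" by (simp add: epi_def)
      moreover have "(u t, (u t, a)) \<in> W n" for n by (simp add: W_def)
      ultimately show "t \<in> (\<Inter>n. {t. \<exists>z\<in>epi (f t). (u t, z) \<in> W n})" by blast
    qed
    ultimately show ?thesis by simp
  qed
  have "{t. f t (u t) \<le> c} \<in> sets M" for c
  proof (cases c)
    case (real a)
    then show ?thesis using \<open>{t. f t (u t) \<le> ereal a} \<in> sets M\<close> by simp
  next
    case PInf
    then show ?thesis using sets.top[of M] by (simp add: space_UNIV)
  next
    case MInf
    have "{t. f t (u t) \<le> c} = (\<Inter>n::nat. {t. f t (u t) \<le> ereal (- real n)})"
    proof (intro equalityI subsetI)
      fix t assume t: "t \<in> (\<Inter>n::nat. {t. f t (u t) \<le> ereal (- real n)})"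
      have "f t (u t) = -\<infinity>"
      proof (rule ereal_bot)
        fix B
        obtain n :: nat where "-B \<le> real n" using real_arch_simple by blast
        moreover have "f t (u t) \<le> ereal (- real n)" using t by blast
        ultimately have "f t (u t) \<le> ereal (- real n)" "ereal (- real n) \<le> ereal B" by simp_all
        then show "f t (u t) \<le> ereal B" by (rule order_trans)
      qed
      then show "t \<in> {t. f t (u t) \<le> c}" by simp
    qed (auto simp: MInf)
    moreover have "(\<Inter>n::nat. {t. f t (u t) \<le> ereal (- real n)}) \<in> sets M" using real by blast
    ultimately show ?thesis by simp
  qed
  then show ?thesis
    unfolding borel_measurable_iff_Iic_ereal by (simp add: vimage_def space_UNIV)
qed

text \<open>
  Strict lower bounds on the conjugate are open conditions on the epigraph; both the measurability of the conjugate
  and the selection of nearly maximising points rest on this.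
\<close>

lemma less_conjugate_iff:
  fixes g :: "'x::real_normed_vector \<Rightarrow> ereal"
  shows "ereal c < conjugate UNIV g \<phi> \<longleftrightarrow> (\<exists>z\<in>epi g. c < \<phi> (fst z) - snd z)"
proof
  assume "ereal c < conjugate UNIV g \<phi>"
  then obtain x where x: "ereal c < ereal (\<phi> x) - g x"
    unfolding conjugate_def less_SUP_iff by blast
  have "g x < ereal (\<phi> x - c)" using x by (cases "g x") auto
  then obtain a where a: "g x < ereal a" "ereal a < ereal (\<phi> x - c)"
    using ereal_dense2 by blast
  then show "\<exists>z\<in>epi g. c < \<phi> (fst z) - snd z"
    by (intro bexI[of _ "(x, a)"]) (auto simp: epi_def)
next
  assume "\<exists>z\<in>epi g. c < \<phi> (fst z) - snd z"
  then obtain x a where x: "g x \<le> ereal a" "c < \<phi> x - a" by (auto simp: epi_def)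
  have "ereal c < ereal (\<phi> x) - ereal a" using x(2) by simp
  also have "\<dots> \<le> ereal (\<phi> x) - g x" using x(1) by (intro ereal_minus_mono) auto
  also have "\<dots> \<le> conjugate UNIV g \<phi>" unfolding conjugate_def by (rule SUP_upper) simp
  finally show "ereal c < conjugate UNIV g \<phi>" .
qed

lemma conjugate_measurable:
  fixes f :: "'t \<Rightarrow> 'x::real_normed_vector \<Rightarrow> ereal" and v :: "'t \<Rightarrow> 'x \<Rightarrow>\<^sub>L real"
  assumes "Lusin_lsc M (\<lambda>t. epi (f t))" and v: "strongly_measurable M v"
  shows "(\<lambda>t. conjugate_integrand f t (v t)) \<in> borel_measurable M"
proof -
  define p where "p t = conjugate_integrand f t (v t)" for t
  have real: "{t. ereal a < p t} \<in> sets M" for a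
  proof -
    define W where "W = {q::('x \<Rightarrow>\<^sub>L real) \<times> ('x \<times> real). a < blinfun_apply (fst q) (fst (snd q)) - snd (snd q)}"
    have "open W" unfolding W_def by (intro open_Collect_less continuous_intros)
    then have "{t. \<exists>z\<in>epi (f t). (v t, z) \<in> W} \<in> sets M"
      by (rule hits_moving_open_in_sets[OF assms(1) v])
    moreover have "{t. \<exists>z\<in>epi (f t). (v t, z) \<in> W} = {t. ereal a < p t}"
      by (simp add: W_def p_def conjugate_integrand_def less_conjugate_iff)
    ultimately show ?thesis by simp
  qed
  have "{t. c < p t} \<in> sets M" for c
  proof -
    have "{t. c < p t} = (\<Union>a\<in>{a\<in>\<rat>. c \<le> ereal a}. {t. ereal a < p t})"
    proof (intro equalityI subsetI)
      fix t assume "t \<in> {t. c < p t}"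
      then obtain a :: rat where "c < ereal (real_of_rat a)" "ereal (real_of_rat a) < p t"
        using ereal_dense3 by blast
      then show "t \<in> (\<Union>a\<in>{a\<in>\<rat>. c \<le> ereal a}. {t. ereal a < p t})"
        by (intro UN_I[of "real_of_rat a"]) auto
    qed auto
    moreover have "countable {a\<in>\<rat>. c \<le> ereal a}"
      by (rule countable_subset[OF _ countable_rat]) auto
    then have "(\<Union>a\<in>{a\<in>\<rat>. c \<le> ereal a}. {t. ereal a < p t}) \<in> sets M"
      using real by (intro sets.countable_UN'')
    ultimately show ?thesis by (simp only:)
  qed
  then show ?thesis
    unfolding borel_measurable_ereal_iff_Ioi by (simp add: vimage_def space_UNIV p_def)
qed

text \<open>
  The pair of \<open>v t\<close> and \<open>q t\<close> is the parameter, and the selected point of the epigraph supplies \<open>u t\<close>; passing to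
  the closure weakens the strict inequality \<open>q t < \<langle>v t, u t\<rangle> - \<alpha>\<close> to a weak one.
\<close>

lemma conjugate_selection:
  fixes f :: "'t \<Rightarrow> 'x::banach \<Rightarrow> ereal" and v :: "'t \<Rightarrow> 'x \<Rightarrow>\<^sub>L real" and q :: "'t \<Rightarrow> real"
  assumes "Lusin_lsc M (\<lambda>t. epi (f t))" "\<And>t. closed (epi (f t))" and v: "strongly_measurable M v"
    and q: "q \<in> borel_measurable M" "AE t in M. ereal (q t) < conjugate_integrand f t (v t)"
  obtains u where "strongly_measurable M u" "AE t in M. f t (u t) \<le> ereal (v t (u t) - q t)"
proof -
  define h where "h = (\<lambda>p::(('x \<Rightarrow>\<^sub>L real) \<times> real) \<times> ('x \<times> real).
    blinfun_apply (fst (fst p)) (fst (snd p)) - snd (snd p))"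
  have h: "continuous_on UNIV h" unfolding h_def by (intro continuous_intros)
  define W where "W = {p. snd (fst p) < h p}"
  have "open W" unfolding W_def by (intro open_Collect_less continuous_intros h)
  have "closed {p. snd (fst p) \<le> h p}" by (intro closed_Collect_le continuous_intros h)
  then have clW: "closure W \<subseteq> {p. snd (fst p) \<le> h p}"
    by (rule closure_minimal[rotated]) (auto simp: W_def)
  have \<theta>: "strongly_measurable M (\<lambda>t. (v t, q t))"
    using strongly_measurable_map2[OF v strongly_measurable_real[OF q(1)], of Pair] tendsto_Pair by blast
  have "AE t in M. \<exists>z\<in>epi (f t). ((v t, q t), z) \<in> W"
    using q(2) by eventually_elim (simp add: W_def h_def conjugate_integrand_def less_conjugate_iff)
  then obtain \<sigma> where \<sigma>: "strongly_measurable M \<sigma>"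
      "AE t in M. \<sigma> t \<in> epi (f t) \<and> ((v t, q t), \<sigma> t) \<in> closure W"
    using moving_open_selection[OF assms(1,2) \<theta> \<open>open W\<close>] by blast
  show thesis
  proof
    show "strongly_measurable M (\<lambda>t. fst (\<sigma> t))"
      using strongly_measurable_map2[OF \<sigma>(1) \<sigma>(1), of "\<lambda>a b. fst a"] tendsto_fst by blast
    show "AE t in M. f t (fst (\<sigma> t)) \<le> ereal (v t (fst (\<sigma> t)) - q t)"
      using \<sigma>(2)
    proof eventually_elim
      case (elim t)
      then have "f t (fst (\<sigma> t)) \<le> ereal (snd (\<sigma> t))"
        by (simp add: epi_def case_prod_beta)
      moreover have "((v t, q t), \<sigma> t) \<in> {p. snd (fst p) \<le> h p}" using elim clW by blast
      then have "ereal (snd (\<sigma> t)) \<le> ereal (v t (fst (\<sigma> t)) - q t)" by (simp add: h_def)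
      ultimately show ?case by (rule order_trans)
    qed
  qed
qed

end

section \<open>Upper integrals\<close>

lemma e2ennreal_zero: "e2ennreal 0 = 0"
  by (simp add: e2ennreal_neg)

lemma upper_integral_mono_AE:
  assumes "AE t in M. a t \<le> b t"
  shows "upper_integral M a \<le> upper_integral M b"
proof -
  have "(\<integral>\<^sup>+ t. e2ennreal (max (a t) 0) \<partial>M) \<le> (\<integral>\<^sup>+ t. e2ennreal (max (b t) 0) \<partial>M)"
    using assms by (intro nn_integral_mono_AE, eventually_elim) (intro e2ennreal_mono max.mono order_refl)
  moreover have "(\<integral>\<^sup>+ t. e2ennreal (- min (b t) 0) \<partial>M) \<le> (\<integral>\<^sup>+ t. e2ennreal (- min (a t) 0) \<partial>M)"
    using assms
    by (intro nn_integral_mono_AE, eventually_elim) (intro e2ennreal_mono, simp only: ereal_minus_le_minus, intro min.mono order_refl)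
  ultimately show ?thesis
    unfolding upper_integral_def by (intro add_mono) (simp_all add: less_eq_ennreal.rep_eq)
qed

lemma upper_integral_cong_AE:
  assumes "AE t in M. a t = b t"
  shows "upper_integral M a = upper_integral M b"
proof (rule antisym)
  show "upper_integral M a \<le> upper_integral M b"
    using assms by (intro upper_integral_mono_AE, eventually_elim) simp
  show "upper_integral M b \<le> upper_integral M a"
    using assms by (intro upper_integral_mono_AE, eventually_elim) simp
qed

lemma upper_integral_integrable:
  fixes h :: "'t \<Rightarrow> real"
  assumes "integrable M h"
  shows "upper_integral M (\<lambda>t. ereal (h t)) = ereal (LINT t|M. h t)"
proof -
  have fin: "enn2ereal x = ereal (enn2real x)" if "x \<noteq> \<infinity>" for x :: ennreal
    using that by (cases x) auto
  have pos: "e2ennreal (max (ereal (h t)) 0) = ennreal (h t)" for t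
    by (cases "h t \<ge> 0") (auto simp: max_def ennreal_neg e2ennreal_zero)
  have neg: "e2ennreal (- min (ereal (h t)) 0) = ennreal (- h t)" for t
    by (cases "h t \<ge> 0") (auto simp: min_def ennreal_neg e2ennreal_zero)
  show ?thesis
    using assms unfolding upper_integral_def pos neg real_lebesgue_integral_def[OF assms] real_integrable_def
    by (simp add: fin)
qed

lemma nn_integral_finite_imp_integrable:
  fixes g :: "'t \<Rightarrow> ennreal"
  assumes [measurable]: "g \<in> borel_measurable M" and fin: "(\<integral>\<^sup>+ t. g t \<partial>M) \<noteq> \<infinity>"
  shows "integrable M (\<lambda>t. enn2real (g t))" "AE t in M. g t \<noteq> \<infinity>"
    "ennreal (LINT t|M. enn2real (g t)) = (\<integral>\<^sup>+ t. g t \<partial>M)"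
proof -
  show ae: "AE t in M. g t \<noteq> \<infinity>" using nn_integral_PInf_AE[OF assms] .
  have eq: "(\<integral>\<^sup>+ t. ennreal (enn2real (g t)) \<partial>M) = (\<integral>\<^sup>+ t. g t \<partial>M)"
    using ae by (intro nn_integral_cong_AE, eventually_elim) (simp add: less_top)
  show int: "integrable M (\<lambda>t. enn2real (g t))"
    using eq fin by (intro integrableI_bounded) (simp_all add: less_top)
  show "ennreal (LINT t|M. enn2real (g t)) = (\<integral>\<^sup>+ t. g t \<partial>M)"
    using nn_integral_eq_integral[OF int] eq by simp
qed

lemma upper_integral_finite_above:
  assumes [measurable]: "p \<in> borel_measurable M" and "upper_integral M p < \<infinity>"
  obtains b where "integrable M b" "AE t in M. p t \<le> ereal (b t)"
proof -
  have "(\<integral>\<^sup>+ t. e2ennreal (max (p t) 0) \<partial>M) \<noteq> \<infinity>"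
    using assms(2) unfolding upper_integral_def by auto
  note * = nn_integral_finite_imp_integrable[OF _ this]
  have 1: "integrable M (\<lambda>t. enn2real (e2ennreal (max (p t) 0)))" by (rule *(1)) measurable
  have "AE t in M. e2ennreal (max (p t) 0) \<noteq> \<infinity>" by (rule *(2)) measurable
  then have "AE t in M. p t \<le> ereal (enn2real (e2ennreal (max (p t) 0)))"
  proof eventually_elim
    case (elim t)
    then show ?case by (cases "p t") (auto simp: max_def ennreal_neg e2ennreal_zero split: if_splits)
  qed
  with 1 show thesis using that by blast
qed

lemma upper_integral_finite:
  assumes [measurable]: "p \<in> borel_measurable M" and fin: "\<bar>upper_integral M p\<bar> \<noteq> \<infinity>"
  obtains h where "integrable M h" "AE t in M. p t = ereal (h t)" "upper_integral M p = ereal (LINT t|M. h t)"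
proof -
  have pf: "(\<integral>\<^sup>+ t. e2ennreal (max (p t) 0) \<partial>M) \<noteq> \<infinity>"
    using fin unfolding upper_integral_def by auto
  have nf: "(\<integral>\<^sup>+ t. e2ennreal (- min (p t) 0) \<partial>M) \<noteq> \<infinity>"
  proof
    assume "(\<integral>\<^sup>+ t. e2ennreal (- min (p t) 0) \<partial>M) = \<infinity>"
    moreover obtain r where "(\<integral>\<^sup>+ t. e2ennreal (max (p t) 0) \<partial>M) = ennreal r" "0 \<le> r"
      using pf by (cases "\<integral>\<^sup>+ t. e2ennreal (max (p t) 0) \<partial>M") simp_all
    ultimately have "upper_integral M p = - \<infinity>" unfolding upper_integral_def by simp
    then show False using fin by simp
  qed
  note P = nn_integral_finite_imp_integrable[OF _ pf] and N = nn_integral_finite_imp_integrable[OF _ nf]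
  define h where "h t = enn2real (e2ennreal (max (p t) 0)) - enn2real (e2ennreal (- min (p t) 0))" for t
  have int: "integrable M h" unfolding h_def by (intro Bochner_Integration.integrable_diff P(1) N(1)) measurable
  have "AE t in M. e2ennreal (max (p t) 0) \<noteq> \<infinity>" by (rule P(2)) measurable
  moreover have "AE t in M. e2ennreal (- min (p t) 0) \<noteq> \<infinity>" by (rule N(2)) measurable
  ultimately have ae: "AE t in M. p t = ereal (h t)"
  proof eventually_elim
    case (elim t)
    show ?case
    proof (cases "p t")
      case (real r)
      then show ?thesis by (cases "r \<ge> 0") (auto simp: h_def max_def min_def e2ennreal_zero)
    qed (use elim in auto)
  qed
  have "upper_integral M p = ereal (LINT t|M. h t)"
    using upper_integral_cong_AE[OF ae] upper_integral_integrable[OF int] by simp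
  with int ae show thesis using that by blast
qed

text \<open>
  Apart from the trivial cases, both functions turn out to be real almost everywhere: \<open>b\<close> has an integrable
  majorant, which through the pointwise inequality bounds \<open>a\<close> from below, and \<open>upper_integral M a\<close> is then finite.
\<close>

lemma upper_integral_Fenchel:
  assumes a: "a \<in> borel_measurable M" "upper_integral M a < \<infinity>" and b: "b \<in> borel_measurable M"
    and h: "integrable M h" and le: "AE t in M. ereal (h t) - a t \<le> b t"
  shows "ereal (LINT t|M. h t) - upper_integral M a \<le> upper_integral M b"
proof (cases "upper_integral M b = \<infinity>")
  case True
  then show ?thesis by simp
next
  case False
  then have "upper_integral M b < \<infinity>" by simp
  then obtain \<beta> where \<beta>: "integrable M \<beta>" "AE t in M. b t \<le> ereal (\<beta> t)"
    by (rule upper_integral_finite_above[OF b])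
  have "AE t in M. ereal (h t - \<beta> t) \<le> a t"
    using \<beta>(2) le
  proof eventually_elim
    case (elim t)
    from elim(2,1) have "ereal (h t) - a t \<le> ereal (\<beta> t)" by (rule order_trans)
    then show ?case by (cases "a t") (simp_all add: algebra_simps)
  qed
  then have "upper_integral M (\<lambda>t. ereal (h t - \<beta> t)) \<le> upper_integral M a"
    by (rule upper_integral_mono_AE)
  then have "ereal (LINT t|M. h t - \<beta> t) \<le> upper_integral M a"
    by (simp only: upper_integral_integrable[OF Bochner_Integration.integrable_diff[OF h \<beta>(1)]])
  then have "\<bar>upper_integral M a\<bar> \<noteq> \<infinity>" using a(2) by (cases "upper_integral M a") simp_all
  then obtain a' where a': "integrable M a'" "AE t in M. a t = ereal (a' t)"
      "upper_integral M a = ereal (LINT t|M. a' t)"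
    by (rule upper_integral_finite[OF a(1)])
  have "AE t in M. ereal (h t - a' t) \<le> b t"
    using le a'(2)
  proof eventually_elim
    case (elim t)
    then show ?case by (simp add: elim(2))
  qed
  then have "upper_integral M (\<lambda>t. ereal (h t - a' t)) \<le> upper_integral M b"
    by (rule upper_integral_mono_AE)
  then have "ereal (LINT t|M. h t - a' t) \<le> upper_integral M b"
    by (simp only: upper_integral_integrable[OF Bochner_Integration.integrable_diff[OF h a'(1)]])
  then show ?thesis
    unfolding a'(3) Bochner_Integration.integral_diff[OF h a'(1)] by simp
qed

text \<open>
  With \<open>e\<close> a strictly positive integrable function, the functions \<open>min(p, k e)\<close> are dominated from above by integrable ones and
  increase to \<open>p\<close>, so their integrals increase to that of \<open>p\<close>; subtracting a small multiple of \<open>e\<close> makes the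
  inequality strict. The minorant \<open>q0\<close> makes the negative part of \<open>p\<close> integrable.
\<close>

lemma (in sigma_finite_measure) upper_integral_approx_below:
  assumes p[measurable]: "p \<in> borel_measurable M" and q0: "integrable M q0" "AE t in M. ereal (q0 t) \<le> p t"
    and r: "ereal r < upper_integral M p"
  obtains q where "integrable M q" "AE t in M. ereal (q t) < p t" "r < (LINT t|M. q t)"
proof -
  obtain e :: "'a \<Rightarrow> real" where e[measurable]: "e \<in> borel_measurable M" "\<And>t. e t > 0" "integrable M e"
    using obtain_positive_integrable_function by metis
  define g where "g t = e2ennreal (max (p t) 0)" for t
  define n where "n t = e2ennreal (- min (p t) 0)" for t
  have [measurable]: "g \<in> borel_measurable M" "n \<in> borel_measurable M"
    unfolding g_def n_def by measurable
  have "(\<integral>\<^sup>+ t. n t \<partial>M) \<le> (\<integral>\<^sup>+ t. ennreal (norm (q0 t)) \<partial>M)"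
    using q0(2)
  proof (intro nn_integral_mono_AE, eventually_elim)
    case (elim t)
    then show ?case
      by (cases "p t") (auto simp: n_def min_def ennreal_leI e2ennreal_zero)
  qed
  then have nf: "(\<integral>\<^sup>+ t. n t \<partial>M) \<noteq> \<infinity>"
    using q0(1) unfolding integrable_iff_bounded by (auto simp: less_top top_unique)
  note n = nn_integral_finite_imp_integrable[OF _ nf]
  define c where "c = r + (LINT t|M. enn2real (n t))"
  define G where "G k t = min (g t) (ennreal (real k * e t))" for k t
  have G_meas[measurable]: "G k \<in> borel_measurable M" for k unfolding G_def by measurable
  have SUP_G: "(SUP k. G k t) = g t" for t
  proof (rule antisym)
    show "(SUP k. G k t) \<le> g t" by (auto simp: G_def intro: SUP_least)
    show "g t \<le> (SUP k. G k t)"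
    proof (cases "g t")
      case (real x)
      obtain k :: nat where "x / e t \<le> real k" using real_arch_simple by blast
      then have "x \<le> real k * e t" using e(2)[of t] by (simp add: field_simps)
      then have "g t = G k t" using real by (simp add: G_def min_def ennreal_leI)
      then show ?thesis by (metis SUP_upper UNIV_I)
    next
      case top
      have "of_nat m \<le> (SUP k. G k t)" for m
      proof -
        obtain k :: nat where "real m / e t \<le> real k" using real_arch_simple by blast
        then have "real m \<le> real k * e t" using e(2)[of t] by (simp add: field_simps)
        then have "of_nat m \<le> G k t" using top by (simp add: G_def ennreal_of_nat_eq_real_of_nat ennreal_leI)
        also have "\<dots> \<le> (SUP k. G k t)" by (rule SUP_upper) simp
        finally show ?thesis .
      qed
      then have "(SUP m. of_nat m) \<le> (SUP k. G k t)" by (intro SUP_least)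
      then show ?thesis using ennreal_SUP_of_nat_eq_top by (simp add: top)
    qed
  qed
  have "incseq G"
    unfolding G_def using e(2) by (intro incseq_SucI le_funI min.mono order_refl ennreal_leI mult_right_mono) (auto intro: less_imp_le)
  then have conv: "(\<integral>\<^sup>+ t. g t \<partial>M) = (SUP k. \<integral>\<^sup>+ t. G k t \<partial>M)"
    using nn_integral_monotone_convergence_SUP[of G M] G_meas by (simp add: SUP_G)
  \<comment> \<open>For negative \<open>c\<close> any \<open>k\<close> will do, but \<open>ennreal c\<close> would be 0 and hide the comparison.\<close>
  have "\<exists>k. c < 0 \<or> ennreal c < (\<integral>\<^sup>+ t. G k t \<partial>M)"
  proof (cases "c < 0")
    case False
    have N: "(\<integral>\<^sup>+ t. n t \<partial>M) = ennreal (LINT t|M. enn2real (n t))" using n(3) by simp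
    have "ereal r < enn2ereal (\<integral>\<^sup>+ t. g t \<partial>M) - ereal (LINT t|M. enn2real (n t))"
      using r unfolding upper_integral_def g_def[symmetric] n_def[symmetric] N
      by (simp add: minus_ereal_def)
    then have "ereal c < enn2ereal (\<integral>\<^sup>+ t. g t \<partial>M)"
      unfolding c_def by (cases "enn2ereal (\<integral>\<^sup>+ t. g t \<partial>M)") auto
    then have "enn2ereal (ennreal c) < enn2ereal (\<integral>\<^sup>+ t. g t \<partial>M)" using False by simp
    then have "ennreal c < (\<integral>\<^sup>+ t. g t \<partial>M)" by (simp add: less_ennreal.rep_eq)
    then show ?thesis unfolding conv less_SUP_iff by blast
  qed auto
  then obtain k where k: "c < 0 \<or> ennreal c < (\<integral>\<^sup>+ t. G k t \<partial>M)" by blast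
  have "(\<integral>\<^sup>+ t. G k t \<partial>M) \<le> (\<integral>\<^sup>+ t. ennreal (norm (real k * e t)) \<partial>M)"
    unfolding G_def real_norm_def by (intro nn_integral_mono min.coboundedI2 ennreal_leI abs_ge_self)
  also have "\<dots> < \<infinity>" using integrable_mult_right[OF e(3), of "real k"] unfolding integrable_iff_bounded by blast
  finally have Gf: "(\<integral>\<^sup>+ t. G k t \<partial>M) \<noteq> \<infinity>" by simp
  note G = nn_integral_finite_imp_integrable[OF G_meas Gf]
  define \<gamma> where "\<gamma> = (LINT t|M. enn2real (G k t))"
  have \<gamma>: "c < \<gamma>"
  proof (cases "c < 0")
    case True
    moreover have "0 \<le> \<gamma>" unfolding \<gamma>_def by (intro Bochner_Integration.integral_nonneg) simp
    ultimately show ?thesis by simp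
  next
    case False
    then have "ennreal c < ennreal \<gamma>" using k G(3) by (simp add: \<gamma>_def)
    then show ?thesis using False by (simp add: ennreal_less_iff)
  qed
  define s where "s = (LINT t|M. e t)"
  have s: "s \<ge> 0" unfolding s_def using e(2) by (intro Bochner_Integration.integral_nonneg less_imp_le)
  \<comment> \<open>The denominator \<open>s + 1\<close> keeps the quotient defined and the loss \<open>\<delta> s\<close> below \<open>\<gamma> - c\<close> also for \<open>s = 0\<close>.\<close>
  define \<delta> where "\<delta> = (\<gamma> - c) / (s + 1)"
  have \<delta>: "\<delta> > 0" using \<gamma> s by (simp add: \<delta>_def)
  have "\<delta> * s < \<gamma> - c" using \<gamma> s by (simp add: \<delta>_def field_simps)
  define q where "q t = enn2real (G k t) - enn2real (n t) - \<delta> * e t" for t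
  have n1: "integrable M (\<lambda>t. enn2real (n t))" by (rule n(1)) measurable
  show thesis
  proof
    show "integrable M q" unfolding q_def using G(1) n1 e(3) by simp
    have "(LINT t|M. q t) = \<gamma> - (LINT t|M. enn2real (n t)) - \<delta> * s"
      unfolding q_def \<gamma>_def s_def using G(1) n1 e(3) by simp
    then show "r < (LINT t|M. q t)" using \<open>\<delta> * s < \<gamma> - c\<close> by (simp add: c_def)
    show "AE t in M. ereal (q t) < p t"
      using q0(2)
    proof eventually_elim
      case (elim t)
      have \<delta>e: "\<delta> * e t > 0" using \<delta> e(2) by simp
      show ?case
      proof (cases "p t")
        case (real x)
        show ?thesis
        proof (cases "x \<ge> 0")
          case True
          then have "g t = ennreal x" "n t = 0" by (auto simp: g_def n_def real max_def min_def e2ennreal_zero)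
          moreover have "G k t \<le> g t" by (simp add: G_def)
          ultimately have "enn2real (G k t) \<le> x" using True by (simp add: enn2real_leI)
          then show ?thesis using \<delta>e \<open>n t = 0\<close> by (simp add: q_def real)
        next
          case False
          then have "G k t = 0" "n t = ennreal (- x)"
            by (auto simp: G_def g_def n_def real max_def min_def e2ennreal_zero)
          then show ?thesis using False \<delta>e by (simp add: q_def real)
        qed
      qed (use elim in auto)
    qed
  qed
qed

section \<open>Essentially bounded functions and their dual\<close>

lemma Linf_spaceD: "u \<in> Linf_space M \<Longrightarrow> strongly_measurable M u"
  by (simp add: Linf_space_def)

lemma Linf_space_add:
  assumes "u \<in> Linf_space M" "w \<in> Linf_space M"
  shows "(\<lambda>t. u t + w t) \<in> Linf_space M"
proof -
  obtain C D where CD: "AE t in M. norm (u t) \<le> C" "AE t in M. norm (w t) \<le> D"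
    using assms by (auto simp: Linf_space_def)
  have "AE t in M. norm (u t + w t) \<le> C + D"
    using CD by eventually_elim (rule norm_triangle_mono)
  moreover have "strongly_measurable M (\<lambda>t. u t + w t)"
    using strongly_measurable_map2[OF Linf_spaceD[OF assms(1)] Linf_spaceD[OF assms(2)], of "(+)"] tendsto_add
    by blast
  ultimately show ?thesis unfolding Linf_space_def by blast
qed

lemma Linf_space_scaleR:
  assumes "u \<in> Linf_space M"
  shows "(\<lambda>t. c *\<^sub>R u t) \<in> Linf_space M"
proof -
  obtain C where C: "AE t in M. norm (u t) \<le> C" using assms by (auto simp: Linf_space_def)
  have "AE t in M. norm (c *\<^sub>R u t) \<le> \<bar>c\<bar> * C"
    using C by eventually_elim (simp add: mult_left_mono)
  moreover have "strongly_measurable M (\<lambda>t. c *\<^sub>R u t)"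
    using strongly_measurable_map2[OF Linf_spaceD[OF assms] Linf_spaceD[OF assms], of "\<lambda>a b. c *\<^sub>R a"]
      tendsto_scaleR[OF tendsto_const] by blast
  ultimately show ?thesis unfolding Linf_space_def by blast
qed

lemma Linf_dualD:
  assumes "\<Lambda> \<in> Linf_dual M"
  shows "\<And>u w. u \<in> Linf_space M \<Longrightarrow> w \<in> Linf_space M \<Longrightarrow> \<Lambda> (\<lambda>t. u t + w t) = \<Lambda> u + \<Lambda> w"
    and "\<And>c u. u \<in> Linf_space M \<Longrightarrow> \<Lambda> (\<lambda>t. c *\<^sub>R u t) = c * \<Lambda> u"
  using assms unfolding Linf_dual_def by simp_all

lemma Linf_dual_diff:
  assumes "\<Lambda> \<in> Linf_dual M" "y \<in> Linf_space M" "x \<in> Linf_space M"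
  shows "\<Lambda> (y - x) = \<Lambda> y - \<Lambda> x"
proof -
  have "y - x = (\<lambda>t. y t + (-1) *\<^sub>R x t)" by (simp add: fun_eq_iff)
  then have "\<Lambda> (y - x) = \<Lambda> y + \<Lambda> (\<lambda>t. (-1) *\<^sub>R x t)"
    using Linf_dualD(1)[OF assms(1,2) Linf_space_scaleR[OF assms(3), of "-1"]] by simp
  then show ?thesis using Linf_dualD(2)[OF assms(1,3), of "-1"] by simp
qed

lemma Linf_dual_add:
  assumes "\<Lambda> \<in> Linf_dual M" "\<Lambda>' \<in> Linf_dual M"
  shows "(\<lambda>u. \<Lambda> u + \<Lambda>' u) \<in> Linf_dual M"
proof -
  obtain K K' where K: "\<And>u. u \<in> Linf_space M \<Longrightarrow> \<bar>\<Lambda> u\<bar> \<le> K * Linf_norm M u"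
      "\<And>u. u \<in> Linf_space M \<Longrightarrow> \<bar>\<Lambda>' u\<bar> \<le> K' * Linf_norm M u"
    using assms unfolding Linf_dual_def by blast
  have "\<bar>\<Lambda> u + \<Lambda>' u\<bar> \<le> (K + K') * Linf_norm M u" if "u \<in> Linf_space M" for u
    using K(1)[OF that] K(2)[OF that] by (simp add: distrib_right)
  then have "\<exists>K. \<forall>u\<in>Linf_space M. \<bar>\<Lambda> u + \<Lambda>' u\<bar> \<le> K * Linf_norm M u" by blast
  then show ?thesis
    using Linf_dualD[OF assms(1)] Linf_dualD[OF assms(2)]
    unfolding Linf_dual_def mem_Collect_eq by (simp add: algebra_simps)
qed

text \<open>
  The infimum that defines the essential supremum norm is attained: the bounds \<open>Inf S + 1 / (n + 1)\<close> hold almost everywhere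
  simultaneously for all \<open>n\<close>.
\<close>

lemma Linf_norm_bound:
  assumes "u \<in> Linf_space M"
  shows "AE t in M. norm (u t) \<le> Linf_norm M u"
proof -
  define S where "S = {C. 0 \<le> C \<and> (AE t in M. norm (u t) \<le> C)}"
  obtain C where C: "AE t in M. norm (u t) \<le> C" using assms by (auto simp: Linf_space_def)
  have "AE t in M. norm (u t) \<le> max 0 C" using C by eventually_elim simp
  then have "max 0 C \<in> S" by (simp add: S_def)
  then have ne: "S \<noteq> {}" by blast
  have bdd: "bdd_below S" by (rule bdd_belowI[of _ 0]) (simp add: S_def)
  have "AE t in M. norm (u t) \<le> Inf S + 1 / real (Suc n)" for n
  proof -
    have "Inf S < Inf S + 1 / real (Suc n)" by simp
    then obtain D where "D \<in> S" "D < Inf S + 1 / real (Suc n)"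
      using cInf_less_iff[OF ne bdd] by blast
    then have "AE t in M. norm (u t) \<le> D" by (simp add: S_def)
    then show ?thesis
    proof eventually_elim
      case (elim t)
      then show ?case using \<open>D < _\<close> by simp
    qed
  qed
  then have "AE t in M. \<forall>n. norm (u t) \<le> Inf S + 1 / real (Suc n)" by (simp add: AE_all_countable)
  then have "AE t in M. norm (u t) \<le> Inf S"
  proof eventually_elim
    case (elim t)
    show ?case
    proof (rule field_le_epsilon)
      fix e :: real assume "0 < e"
      then obtain n where "1 / real (Suc n) < e" using nat_approx_posE by blast
      then show "norm (u t) \<le> Inf S + e" using elim[rule_format, of n] by linarith
    qed
  qed
  then show ?thesis unfolding Linf_norm_def S_def .
qed

context complete_borel_measure
begin

lemma pairing_integrable:
  fixes v :: "'t \<Rightarrow> 'x::real_normed_vector \<Rightarrow>\<^sub>L real"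
  assumes v: "v \<in> L1_space M" and u: "u \<in> Linf_space M"
  shows "integrable M (\<lambda>t. norm (v t))" "integrable M (\<lambda>t. v t (u t))"
proof -
  have vm: "strongly_measurable M v" and vf: "(\<integral>\<^sup>+ t. ennreal (norm (v t)) \<partial>M) < \<infinity>"
    using v by (auto simp: L1_space_def)
  show int: "integrable M (\<lambda>t. norm (v t))"
  proof (rule integrableI_bounded)
    show "(\<lambda>t. norm (v t)) \<in> borel_measurable M"
      by (rule measurable_compose[OF strongly_measurable_imp_measurable[OF complete vm] borel_measurable_norm])
    show "(\<integral>\<^sup>+ t. ennreal (norm (norm (v t))) \<partial>M) < \<infinity>" using vf by simp
  qed
  show "integrable M (\<lambda>t. v t (u t))"
  proof (rule Bochner_Integration.integrable_bound)
    show "integrable M (\<lambda>t. Linf_norm M u * norm (v t))" using int by simp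
    have "strongly_measurable M (\<lambda>t. v t (u t))"
      using strongly_measurable_map2[OF vm Linf_spaceD[OF u], of blinfun_apply] blinfun.tendsto by blast
    then show "(\<lambda>t. v t (u t)) \<in> borel_measurable M"
      by (rule strongly_measurable_imp_measurable[OF complete])
    show "AE t in M. norm (v t (u t)) \<le> norm (Linf_norm M u * norm (v t))"
      using Linf_norm_bound[OF u]
    proof eventually_elim
      case (elim t)
      have "norm (v t (u t)) \<le> norm (v t) * norm (u t)" by (rule norm_blinfun)
      also have "\<dots> \<le> norm (v t) * Linf_norm M u" using elim by (rule mult_left_mono) simp
      also have "\<dots> \<le> norm (Linf_norm M u * norm (v t))" by (simp add: mult.commute)
      finally show ?case .
    qed
  qed
qed

lemma L1_functional_in_Linf_dual:
  fixes v :: "'t \<Rightarrow> 'x::real_normed_vector \<Rightarrow>\<^sub>L real"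
  assumes v: "v \<in> L1_space M"
  shows "L1_functional M v \<in> Linf_dual M"
proof -
  have "\<bar>L1_functional M v u\<bar> \<le> (LINT t|M. norm (v t)) * Linf_norm M u" if u: "u \<in> Linf_space M" for u
  proof -
    note int = pairing_integrable[OF v u]
    have "\<bar>L1_functional M v u\<bar> \<le> (LINT t|M. \<bar>v t (u t)\<bar>)"
      unfolding L1_functional_def by (rule integral_abs_bound)
    also have "\<dots> \<le> (LINT t|M. norm (v t) * Linf_norm M u)"
    proof (rule integral_mono_AE)
      show "AE t in M. \<bar>v t (u t)\<bar> \<le> norm (v t) * Linf_norm M u"
        using Linf_norm_bound[OF u]
      proof eventually_elim
        case (elim t)
        have "\<bar>v t (u t)\<bar> \<le> norm (v t) * norm (u t)" using norm_blinfun[of "v t" "u t"] by simp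
        also have "\<dots> \<le> norm (v t) * Linf_norm M u" using elim by (rule mult_left_mono) simp
        finally show ?case .
      qed
    qed (use int in simp_all)
    finally show ?thesis by simp
  qed
  then have "\<exists>K. \<forall>u\<in>Linf_space M. \<bar>L1_functional M v u\<bar> \<le> K * Linf_norm M u" by blast
  then show ?thesis
    unfolding Linf_dual_def mem_Collect_eq
    by (simp add: L1_functional_def blinfun.add_right blinfun.scaleR_right pairing_integrable[OF v])
qed

end

section \<open>The conjugate of an integral functional\<close>

lemma Fenchel_Young_pointwise:
  "ereal (blinfun_apply v y) - f t y \<le> conjugate_integrand f t v"
  unfolding conjugate_integrand_def conjugate_def by (rule SUP_upper) simp

lemma support_fun_upper:
  assumes "C \<subseteq> Z" "z \<in> C"
  shows "ereal (\<phi> z) \<le> support_fun Z C \<phi>"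
proof -
  have "ereal (\<phi> z) = ereal (\<phi> z) - indicator_delta C z" using assms(2) by (simp add: indicator_delta_def)
  also have "\<dots> \<le> support_fun Z C \<phi>"
    unfolding support_fun_def conjugate_def using assms by (intro SUP_upper) blast
  finally show ?thesis .
qed

lemma less_support_funD:
  assumes "ereal s < support_fun Z C \<phi>"
  obtains z where "z \<in> C" "s < \<phi> z"
proof -
  obtain z where z: "z \<in> Z" "ereal s < ereal (\<phi> z) - indicator_delta C z"
    using assms unfolding support_fun_def conjugate_def less_SUP_iff by blast
  then have "z \<in> C" by (cases "z \<in> C") (simp_all add: indicator_delta_def)
  with z show thesis using that by (simp add: indicator_delta_def)
qed

lemma support_fun_least:
  assumes "\<And>z. z \<in> C \<Longrightarrow> ereal (\<phi> z) \<le> c"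
  shows "support_fun Z C \<phi> \<le> c"
  unfolding support_fun_def conjugate_def
proof (rule SUP_least)
  fix z assume "z \<in> Z"
  show "ereal (\<phi> z) - indicator_delta C z \<le> c"
    using assms[of z] by (cases "z \<in> C") (simp_all add: indicator_delta_def)
qed

text \<open>
  A sum is the supremum of the sums of real strict lower bounds of its terms. Excluding \<open>-\<infinity>\<close> is essential,
  since \<open>\<infinity> + -\<infinity> = \<infinity>\<close> while \<open>-\<infinity>\<close> has no real strict lower bounds.
\<close>

lemma ereal_add_le_of_less:
  fixes a b c :: ereal
  assumes "a \<noteq> -\<infinity>" "b \<noteq> -\<infinity>" and le: "\<And>r s. ereal r < a \<Longrightarrow> ereal s < b \<Longrightarrow> ereal (r + s) \<le> c"
  shows "a + b \<le> c"
proof (rule ereal_le_real)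
  fix C assume "c \<le> ereal C"
  show "a + b \<le> ereal C"
  proof (rule ccontr)
    assume "\<not> a + b \<le> ereal C"
    then have C: "ereal C < a + b" by simp
    have "\<exists>r s. ereal r < a \<and> ereal s < b \<and> C < r + s"
    proof (cases a)
      case (real x)
      then have "ereal (C - x) < b" using C by (cases b) auto
      then obtain s where s: "ereal (C - x) < ereal s" "ereal s < b" using ereal_dense2 by blast
      then show ?thesis using real
        by (intro exI[of _ "x - (s - (C - x)) / 2"] exI[of _ s]) (simp add: field_simps)
    next
      case PInf
      obtain s where "ereal s < b" using assms(2) ereal_dense2[of "-\<infinity>" b] by auto
      then show ?thesis using PInf by (intro exI[of _ "C - s + 1"] exI[of _ s]) simp
    next
      case MInf
      then show ?thesis using assms(1) by simp
    qed
    then obtain r s where "ereal r < a" "ereal s < b" "C < r + s" by blast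
    with le[of r s] have "ereal (r + s) \<le> ereal C" using \<open>c \<le> ereal C\<close> by (meson order_trans)
    then show False using \<open>C < r + s\<close> by simp
  qed
qed

text \<open>
  Lower semicontinuity of the epigraphs on large compact sets supplies measurable selections, and closedness keeps
  the limits of approximate selections inside the epigraphs. Every admissible integrand has both properties.
\<close>

locale normal_integrand = complete_borel_measure M
    for M :: "'t::metric_space measure" +
  fixes f :: "'t \<Rightarrow> 'x::banach \<Rightarrow> ereal"
  assumes epi_lsc: "Lusin_lsc M (\<lambda>t. epi (f t))" and epi_closed: "\<And>t. closed (epi (f t))"
begin

abbreviation "dom_I \<equiv> dom_integral_functional M f"

lemma Fenchel_Young_integral:
  assumes v: "v \<in> L1_space M" and u: "u \<in> dom_I"
  shows "ereal (L1_functional M v u) - integral_functional M f u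
    \<le> integral_functional M (conjugate_integrand f) v"
  unfolding L1_functional_def integral_functional_def
proof (rule upper_integral_Fenchel)
  have uL: "u \<in> Linf_space M" "integral_functional M f u < \<infinity>"
    using u by (auto simp: dom_integral_functional_def)
  show "(\<lambda>t. f t (u t)) \<in> borel_measurable M"
    by (rule composition_measurable[OF epi_lsc epi_closed Linf_spaceD[OF uL(1)]])
  show "upper_integral M (\<lambda>t. f t (u t)) < \<infinity>" using uL(2) unfolding integral_functional_def .
  show "(\<lambda>t. conjugate_integrand f t (v t)) \<in> borel_measurable M"
    using conjugate_measurable[OF epi_lsc] v by (simp add: L1_space_def)
  show "integrable M (\<lambda>t. v t (u t))" by (rule pairing_integrable(2)[OF v uL(1)])
  show "AE t in M. ereal (v t (u t)) - f t (u t) \<le> conjugate_integrand f t (v t)"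
    by (intro AE_I2 Fenchel_Young_pointwise)
qed

lemma conjugate_integral_not_MInf:
  assumes v: "v \<in> L1_space M" and u: "u \<in> dom_I"
  shows "integral_functional M (conjugate_integrand f) v \<noteq> -\<infinity>"
proof
  assume "integral_functional M (conjugate_integrand f) v = -\<infinity>"
  with Fenchel_Young_integral[OF v u] have "ereal (L1_functional M v u) - integral_functional M f u = -\<infinity>"
    by simp
  moreover have "integral_functional M f u < \<infinity>" using u by (simp add: dom_integral_functional_def)
  ultimately show False by (cases "integral_functional M f u") simp_all
qed

lemma conjugate_integral_functional_le:
  assumes v: "v \<in> L1_space M" and u: "u \<in> Linf_space M" and ls: "ls \<in> Linf_dual M"
  shows "ereal (L1_functional M v u + ls u) - integral_functional M f u
    \<le> integral_functional M (conjugate_integrand f) v + support_fun (Linf_space M) dom_I ls"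
proof (cases "u \<in> dom_I")
  case True
  have sub: "dom_I \<subseteq> Linf_space M" by (auto simp: dom_integral_functional_def)
  have "ereal (L1_functional M v u + ls u) - integral_functional M f u =
      (ereal (L1_functional M v u) - integral_functional M f u) + ereal (ls u)"
    by (cases "integral_functional M f u") simp_all
  also have "\<dots> \<le> integral_functional M (conjugate_integrand f) v + support_fun (Linf_space M) dom_I ls"
    by (intro add_mono Fenchel_Young_integral[OF v True] support_fun_upper[OF sub True])
  finally show ?thesis .
next
  case False
  then have "integral_functional M f u = \<infinity>" using u by (simp add: dom_integral_functional_def)
  then show ?thesis by simp
qed

text \<open>
  The core of the formula: the nearly maximising function \<open>u\<close> of the regular part is spliced with \<open>w\<close>
  along the sets \<open>C n\<close>, which lie in sets that the singular functional does not see.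
\<close>

lemma singular_conjugate_approx:
  assumes v: "v \<in> L1_space M" and ls: "ls \<in> Lsing M" and w: "w \<in> dom_I"
    and r: "ereal r < integral_functional M (conjugate_integrand f) v"
  shows "\<exists>u\<in>Linf_space M. ereal (r + ls w) \<le> ereal (L1_functional M v u + ls u) - integral_functional M f u"
proof (cases "integral_functional M f w = -\<infinity>")
  case True
  then show ?thesis using w by (intro bexI[of _ w]) (simp_all add: dom_integral_functional_def)
next
  case False
  have wL: "w \<in> Linf_space M" "integral_functional M f w < \<infinity>"
    using w by (auto simp: dom_integral_functional_def)
  have vm: "strongly_measurable M v" using v by (simp add: L1_space_def)
  have fw_meas: "(\<lambda>t. f t (w t)) \<in> borel_measurable M"
    by (rule composition_measurable[OF epi_lsc epi_closed Linf_spaceD[OF wL(1)]])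
  have "\<bar>upper_integral M (\<lambda>t. f t (w t))\<bar> \<noteq> \<infinity>"
    using False wL(2) unfolding integral_functional_def by auto
  then obtain fw where fw: "integrable M fw" "AE t in M. f t (w t) = ereal (fw t)"
    by (rule upper_integral_finite[OF fw_meas])
  define q0 where "q0 t = v t (w t) - fw t" for t
  have q0: "integrable M q0" unfolding q0_def using pairing_integrable(2)[OF v wL(1)] fw(1) by simp
  have "AE t in M. ereal (q0 t) \<le> conjugate_integrand f t (v t)"
    using fw(2)
  proof eventually_elim
    case (elim t)
    then show ?case using Fenchel_Young_pointwise[of "v t" "w t" f t] by (simp add: q0_def)
  qed
  then obtain q where q: "integrable M q" "AE t in M. ereal (q t) < conjugate_integrand f t (v t)"
      "r < (LINT t|M. q t)"
    by (rule upper_integral_approx_below[OF conjugate_measurable[OF epi_lsc vm] q0 _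
          r[unfolded integral_functional_def]])
  obtain u where u: "strongly_measurable M u" "AE t in M. f t (u t) \<le> ereal (v t (u t) - q t)"
    by (rule conjugate_selection[OF epi_lsc epi_closed vm borel_measurable_integrable[OF q(1)] q(2)])
  have lsL: "ls \<in> Linf_dual M" using ls by (simp add: Lsing_def)
  have "\<exists>A :: nat \<Rightarrow> 't set. incseq A \<and> range A \<subseteq> sets M \<and> (\<Union>n. A n) = space M \<and>
       (\<forall>n. \<forall>B\<in>sets M. emeasure M B < \<infinity> \<longrightarrow>
          (\<forall>u\<in>Linf_space M. ls (\<lambda>t. indicator (A n \<inter> B) t *\<^sub>R u t) = 0))"
    using ls unfolding Lsing_def mem_Collect_eq by (rule conjunct2)
  then obtain A :: "nat \<Rightarrow> 't set" where A: "incseq A" "range A \<subseteq> sets M" "(\<Union>n. A n) = space M"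
    and A_ls: "\<forall>n. \<forall>B\<in>sets M. emeasure M B < \<infinity> \<longrightarrow>
          (\<forall>u\<in>Linf_space M. ls (\<lambda>t. indicator (A n \<inter> B) t *\<^sub>R u t) = 0)"
    by (elim exE conjE)
  obtain S :: "nat \<Rightarrow> 't set" where S: "range S \<subseteq> sets M" "(\<Union>i. S i) = space M"
    "\<And>i. emeasure M (S i) \<noteq> \<infinity>" "incseq S"
    using sigma_finite_incseq by metis
  \<comment> \<open>Three restrictions at once: \<open>u\<close> is bounded on \<open>C n\<close>, and intersecting with \<open>A n\<close> and with a set of
    finite measure lets \<open>ls\<close> vanish on all functions that live on \<open>C n\<close>.\<close>
  define C where "C n = {t. norm (u t) \<le> real n} \<inter> (A n \<inter> S n)" for n
  have "(\<lambda>t. norm (u t)) \<in> borel_measurable M"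
    by (rule measurable_compose[OF strongly_measurable_imp_measurable[OF complete u(1)] borel_measurable_norm])
  then have "{t \<in> space M. norm (u t) \<le> real n} \<in> sets M" for n by measurable
  then have C_sets[measurable]: "C n \<in> sets M" for n
    unfolding C_def using A(2) S(1) by (intro sets.Int) (auto simp: space_UNIV)
  define U where "U n t = (if t \<in> C n then u t else w t)" for n t
  define g where "g n t = (if t \<in> C n then u t + (-1) *\<^sub>R w t else 0)" for n t
  obtain K where K: "AE t in M. norm (w t) \<le> K" using wL(1) by (auto simp: Linf_space_def)
  have zero: "strongly_measurable M (\<lambda>t. 0 :: 'x)"
    unfolding strongly_measurable_def by (intro exI[of _ "\<lambda>n t. 0"]) simp
  have diff: "strongly_measurable M (\<lambda>t. u t + (-1) *\<^sub>R w t)"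
    by (rule strongly_measurable_map2[OF u(1) Linf_spaceD[OF wL(1)], of "\<lambda>a b. a + (-1) *\<^sub>R b"])
      (intro tendsto_intros)
  have g: "g n \<in> Linf_space M" for n
  proof -
    have "strongly_measurable M (g n)"
      unfolding g_def by (rule strongly_measurable_If[OF C_sets diff zero])
    moreover have "AE t in M. norm (g n t) \<le> real n + \<bar>K\<bar>"
      using K
    proof eventually_elim
      case (elim t)
      show ?case
      proof (cases "t \<in> C n")
        case True
        then have "norm (u t) \<le> real n" by (simp add: C_def)
        moreover have "norm (u t - w t) \<le> norm (u t) + norm (w t)" by (rule norm_triangle_ineq4)
        ultimately show ?thesis using True elim by (simp add: g_def)
      qed (simp add: g_def)
    qed
    ultimately show ?thesis unfolding Linf_space_def by blast
  qed
  have U_eq: "U n = (\<lambda>t. g n t + w t)" for n by (auto simp: U_def g_def)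
  have U: "U n \<in> Linf_space M" for n unfolding U_eq by (rule Linf_space_add[OF g wL(1)])
  have ls_U: "ls (U n) = ls w" for n
  proof -
    have "indicator (A n \<inter> S n) t *\<^sub>R g n t = g n t" for t
      by (cases "t \<in> A n \<inter> S n") (auto simp: g_def C_def)
    moreover have "S n \<in> sets M" "emeasure M (S n) < \<infinity>"
      using S(1) S(3)[of n] by (auto simp: less_top)
    then have "ls (\<lambda>t. indicator (A n \<inter> S n) t *\<^sub>R g n t) = 0"
      using A_ls g by blast
    ultimately have "ls (g n) = 0" by simp
    then show ?thesis unfolding U_eq using Linf_dualD(1)[OF lsL g wL(1)] by simp
  qed
  define Q where "Q n t = (if t \<in> C n then q t else q0 t)" for n t
  have Q_meas: "Q n \<in> borel_measurable M" for n
    unfolding Q_def using borel_measurable_integrable[OF q(1)] borel_measurable_integrable[OF q0] by measurable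
  have dom: "integrable M (\<lambda>t. \<bar>q t\<bar> + \<bar>q0 t\<bar>)" using q(1) q0 by simp
  have Q_le: "AE t in M. norm (Q n t) \<le> \<bar>q t\<bar> + \<bar>q0 t\<bar>" for n by (simp add: Q_def)
  have Q_int: "integrable M (Q n)" for n
    by (rule Bochner_Integration.integrable_bound[OF dom Q_meas]) (simp add: Q_def)
  have "(\<lambda>n. Q n t) \<longlonglongrightarrow> q t" for t
  proof (rule tendsto_eventually)
    have "t \<in> (\<Union>n. A n)" "t \<in> (\<Union>n. S n)" using A(3) S(2) by (simp_all add: space_UNIV)
    then obtain i j where ij: "t \<in> A i" "t \<in> S j" by blast
    obtain k :: nat where k: "norm (u t) \<le> real k" using real_arch_simple by blast
    have "Q n t = q t" if "n \<ge> max i (max j k)" for n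
    proof -
      have "A i \<subseteq> A n" "S j \<subseteq> S n" using A(1) S(4) that by (auto simp: incseq_def)
      then have "t \<in> C n" using ij k that by (auto simp: C_def)
      then show ?thesis by (simp add: Q_def)
    qed
    then show "\<forall>\<^sub>F n in sequentially. Q n t = q t" unfolding eventually_sequentially by blast
  qed
  then have "(\<lambda>n. LINT t|M. Q n t) \<longlonglongrightarrow> (LINT t|M. q t)"
    by (intro integral_dominated_convergence[OF borel_measurable_integrable[OF q(1)] Q_meas dom _ Q_le]) simp
  then have "\<forall>\<^sub>F n in sequentially. r < (LINT t|M. Q n t)" using q(3) by (rule order_tendstoD)
  then obtain n where n: "r < (LINT t|M. Q n t)" by (auto simp: eventually_sequentially)
  have int: "integrable M (\<lambda>t. v t (U n t))" by (rule pairing_integrable(2)[OF v U])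
  have "AE t in M. f t (U n t) \<le> ereal (v t (U n t) - Q n t)"
    using u(2) fw(2)
  proof eventually_elim
    case (elim t)
    then show ?case by (simp add: U_def Q_def q0_def)
  qed
  then have "integral_functional M f (U n) \<le> upper_integral M (\<lambda>t. ereal (v t (U n t) - Q n t))"
    unfolding integral_functional_def by (rule upper_integral_mono_AE)
  also have "\<dots> = ereal (L1_functional M v (U n) - (LINT t|M. Q n t))"
    unfolding upper_integral_integrable[OF Bochner_Integration.integrable_diff[OF int Q_int]]
      Bochner_Integration.integral_diff[OF int Q_int] L1_functional_def ..
  finally have *: "integral_functional M f (U n) \<le> ereal (L1_functional M v (U n) - (LINT t|M. Q n t))" .
  have "ereal (r + ls w) \<le> ereal (L1_functional M v (U n) + ls (U n)) - integral_functional M f (U n)"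
    using * n by (cases "integral_functional M f (U n)") (simp_all add: ls_U)
  then show ?thesis using U by blast
qed

theorem conjugate_integral_functional:
  assumes v: "v \<in> L1_space M" and ls: "ls \<in> Lsing M" and ne: "dom_I \<noteq> {}"
  shows "conjugate (Linf_space M) (integral_functional M f) (\<lambda>u. L1_functional M v u + ls u)
    = integral_functional M (conjugate_integrand f) v + support_fun (Linf_space M) dom_I ls"
proof -
  obtain w where w: "w \<in> dom_I" using ne by blast
  have lsL: "ls \<in> Linf_dual M" using ls by (simp add: Lsing_def)
  have sub: "dom_I \<subseteq> Linf_space M" by (auto simp: dom_integral_functional_def)
  show ?thesis
  proof (rule antisym)
    show "conjugate (Linf_space M) (integral_functional M f) (\<lambda>u. L1_functional M v u + ls u)
        \<le> integral_functional M (conjugate_integrand f) v + support_fun (Linf_space M) dom_I ls"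
      unfolding conjugate_def by (intro SUP_least conjugate_integral_functional_le[OF v _ lsL])
    show "integral_functional M (conjugate_integrand f) v + support_fun (Linf_space M) dom_I ls
        \<le> conjugate (Linf_space M) (integral_functional M f) (\<lambda>u. L1_functional M v u + ls u)"
    proof (rule ereal_add_le_of_less)
      show "integral_functional M (conjugate_integrand f) v \<noteq> -\<infinity>"
        by (rule conjugate_integral_not_MInf[OF v w])
      show "support_fun (Linf_space M) dom_I ls \<noteq> -\<infinity>"
        using support_fun_upper[OF sub w, of ls] by auto
      fix r s assume r: "ereal r < integral_functional M (conjugate_integrand f) v"
        and "ereal s < support_fun (Linf_space M) dom_I ls"
      then obtain z where z: "z \<in> dom_I" "s < ls z" by (metis less_support_funD)
      obtain u where u: "u \<in> Linf_space M"
          "ereal (r + ls z) \<le> ereal (L1_functional M v u + ls u) - integral_functional M f u"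
        using singular_conjugate_approx[OF v ls z(1) r] by blast
      have "ereal (r + s) \<le> ereal (r + ls z)" using z(2) by simp
      also note u(2)
      also have "ereal (L1_functional M v u + ls u) - integral_functional M f u
          \<le> conjugate (Linf_space M) (integral_functional M f) (\<lambda>u. L1_functional M v u + ls u)"
        unfolding conjugate_def by (rule SUP_upper[OF u(1)])
      finally show "ereal (r + s) \<le> \<dots>" .
    qed
  qed
qed

text \<open>
  By the conjugate formula, membership in the subdifferential means
  \<open>\<I>\<^sub>f\<^sub>*(v) + \<sigma>(ls) \<le> L1_functional M v x + ls x - \<I>\<^sub>f(x) + \<epsilon>\<close>. All terms are then finite, and the slack is
  distributed as \<open>\<epsilon>1 = \<integral> \<ell>\<close> for the pointwise Fenchel gap \<open>\<ell>\<close> and \<open>\<epsilon>2 = \<sigma>(ls) - ls x\<close>. Conversely, the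
  condition on \<open>v\<close> bounds the first term on the left and the condition on \<open>ls\<close> the second.
\<close>

theorem eps_subdiff_integral_functional:
  assumes v: "v \<in> L1_space M" and ls: "ls \<in> Lsing M"
    and x: "x \<in> dom_I" and fin: "integral_functional M f x \<noteq> -\<infinity>"
  shows "(\<lambda>u. L1_functional M v u + ls u)
      \<in> eps_subdiff (Linf_space M) (Linf_dual M) \<epsilon> (integral_functional M f) x
    \<longleftrightarrow> (\<exists>\<epsilon>1 \<epsilon>2. 0 \<le> \<epsilon>1 \<and> 0 \<le> \<epsilon>2 \<and> \<epsilon>1 + \<epsilon>2 \<le> \<epsilon> \<and>
          (\<exists>l\<in>Z_set M \<epsilon>1.
             (AE t in M. blinfun_apply (v t)
                \<in> eps_subdiff UNIV (Collect bounded_linear) (l t) (f t) (x t)) \<and>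
             ls \<in> eps_normal (Linf_space M) (Linf_dual M) \<epsilon>2 dom_I x))"
    (is "?\<Lambda> \<in> ?sub \<longleftrightarrow> ?R")
proof -
  let ?I = "integral_functional M f" and ?J = "integral_functional M (conjugate_integrand f)"
  let ?\<sigma> = "support_fun (Linf_space M) dom_I ls"
  have sub: "dom_I \<subseteq> Linf_space M" by (auto simp: dom_integral_functional_def)
  have xL: "x \<in> Linf_space M" "?I x < \<infinity>" using x by (auto simp: dom_integral_functional_def)
  have vm: "strongly_measurable M v" using v by (simp add: L1_space_def)
  have lsL: "ls \<in> Linf_dual M" using ls by (simp add: Lsing_def)
  have \<Lambda>: "?\<Lambda> \<in> Linf_dual M" by (rule Linf_dual_add[OF L1_functional_in_Linf_dual[OF v] lsL])
  have "\<bar>upper_integral M (\<lambda>t. f t (x t))\<bar> \<noteq> \<infinity>"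
    using fin xL(2) unfolding integral_functional_def by (cases "upper_integral M (\<lambda>t. f t (x t))") simp_all
  then obtain a where a: "integrable M a" "AE t in M. f t (x t) = ereal (a t)"
      "upper_integral M (\<lambda>t. f t (x t)) = ereal (LINT t|M. a t)"
    by (rule upper_integral_finite[OF composition_measurable[OF epi_lsc epi_closed Linf_spaceD[OF xL(1)]]])
  have Ix: "?I x = ereal (LINT t|M. a t)" using a(3) unfolding integral_functional_def .
  define h where "h t = v t (x t)" for t
  have h: "integrable M h" unfolding h_def by (rule pairing_integrable(2)[OF v xL(1)])
  have vx: "L1_functional M v x = (LINT t|M. h t)" by (simp add: L1_functional_def h_def)
  have \<Lambda>x: "?\<Lambda> (y - x) = ?\<Lambda> y - ?\<Lambda> x" if "y \<in> Linf_space M" for y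
    by (rule Linf_dual_diff[OF \<Lambda> that xL(1)])
  have sub_iff: "?\<Lambda> \<in> ?sub \<longleftrightarrow> conjugate (Linf_space M) ?I ?\<Lambda> \<le> ereal (?\<Lambda> x - (LINT t|M. a t) + \<epsilon>)"
  proof -
    have "ereal (?\<Lambda> (y - x)) \<le> ?I y - ?I x + ereal \<epsilon> \<longleftrightarrow>
        ereal (?\<Lambda> y) - ?I y \<le> ereal (?\<Lambda> x - (LINT t|M. a t) + \<epsilon>)" if "y \<in> Linf_space M" for y
      unfolding \<Lambda>x[OF that] Ix by (cases "?I y") (auto simp: algebra_simps)
    then show ?thesis
      unfolding eps_subdiff_def conjugate_def SUP_le_iff using \<Lambda> by (simp add: Ix)
  qed
  have split: "?\<Lambda> \<in> ?sub \<longleftrightarrow> ?J v + ?\<sigma> \<le> ereal (?\<Lambda> x - (LINT t|M. a t) + \<epsilon>)"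
  proof -
    have ne: "dom_I \<noteq> {}" using x by blast
    show ?thesis unfolding sub_iff conjugate_integral_functional[OF v ls ne] by (rule refl)
  qed
  show ?thesis
  proof
    assume "?\<Lambda> \<in> ?sub"
    then have le: "?J v + ?\<sigma> \<le> ereal (?\<Lambda> x - (LINT t|M. a t) + \<epsilon>)" unfolding split .
    have "ereal (ls x) \<le> ?\<sigma>" by (rule support_fun_upper[OF sub x])
    with le conjugate_integral_not_MInf[OF v x] obtain s where s: "?\<sigma> = ereal s" "ls x \<le> s" "\<bar>?J v\<bar> \<noteq> \<infinity>"
      by (cases "?\<sigma>"; cases "?J v") auto
    from s(3) obtain b where b: "integrable M b" "AE t in M. conjugate_integrand f t (v t) = ereal (b t)"
        "?J v = ereal (LINT t|M. b t)"
      unfolding integral_functional_def by (rule upper_integral_finite[OF conjugate_measurable[OF epi_lsc vm]])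
    define l where "l t = a t + b t - h t" for t
    have l: "integrable M l" unfolding l_def using a(1) b(1) h by simp
    have l_pos: "AE t in M. 0 \<le> l t"
      using a(2) b(2)
    proof eventually_elim
      case (elim t)
      then show ?case using Fenchel_Young_pointwise[of "v t" "x t" f t] by (simp add: l_def h_def)
    qed
    have l_int: "(LINT t|M. l t) = (LINT t|M. a t) + (LINT t|M. b t) - (LINT t|M. h t)"
      unfolding l_def using a(1) b(1) h by simp
    have "l \<in> Z_set M (LINT t|M. l t)" using l l_pos by (simp add: Z_set_def)
    moreover have "AE t in M. blinfun_apply (v t)
        \<in> eps_subdiff UNIV (Collect bounded_linear) (l t) (f t) (x t)"
      using a(2) b(2)
    proof eventually_elim
      case (elim t)
      have "ereal (v t (y - x t)) \<le> f t y - f t (x t) + ereal (l t)" for y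
        using Fenchel_Young_pointwise[of "v t" y f t] elim
        by (cases "f t y") (auto simp: l_def h_def blinfun.diff_right)
      then show ?case using elim by (simp add: eps_subdiff_def blinfun.bounded_linear_right)
    qed
    moreover have "ls \<in> eps_normal (Linf_space M) (Linf_dual M) (s - ls x) dom_I x"
    proof -
      have "ereal (ls (y - x)) \<le> indicator_delta dom_I y - indicator_delta dom_I x + ereal (s - ls x)"
        if y: "y \<in> Linf_space M" for y
      proof (cases "y \<in> dom_I")
        case True
        then have "ls y \<le> s" using support_fun_upper[OF sub True, of ls] s(1) by simp
        then show ?thesis using True x by (simp add: indicator_delta_def Linf_dual_diff[OF lsL y xL(1)])
      qed (use x in \<open>simp add: indicator_delta_def\<close>)
      then show ?thesis using x lsL by (simp add: eps_normal_def eps_subdiff_def indicator_delta_def)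
    qed
    moreover have "0 \<le> (LINT t|M. l t)" using l_pos by (rule integral_nonneg_AE)
    moreover have "(LINT t|M. l t) + (s - ls x) \<le> \<epsilon>"
      using le by (simp add: s(1) b(3) l_int vx)
    ultimately show ?R using s(2) by (intro exI[of _ "LINT t|M. l t"] exI[of _ "s - ls x"]) auto
  next
    assume ?R
    then obtain \<epsilon>1 \<epsilon>2 l where eps: "\<epsilon>1 + \<epsilon>2 \<le> \<epsilon>" and l: "l \<in> Z_set M \<epsilon>1"
      and vt: "AE t in M. blinfun_apply (v t) \<in> eps_subdiff UNIV (Collect bounded_linear) (l t) (f t) (x t)"
      and normal: "ls \<in> eps_normal (Linf_space M) (Linf_dual M) \<epsilon>2 dom_I x"
      by blast
    have lint: "integrable M l" "(LINT t|M. l t) \<le> \<epsilon>1" using l by (auto simp: Z_set_def)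
    have "AE t in M. conjugate_integrand f t (v t) \<le> ereal (l t + h t - a t)"
      using vt a(2)
    proof eventually_elim
      case (elim t)
      then have "ereal (v t (y - x t)) \<le> f t y - f t (x t) + ereal (l t)" for y
        by (auto simp: eps_subdiff_def split: if_splits)
      then have "ereal (v t y) - f t y \<le> ereal (l t + h t - a t)" for y
        using elim(2) by (cases "f t y") (auto simp: h_def blinfun.diff_right algebra_simps dest!: meta_spec[of _ y])
      then show ?case unfolding conjugate_integrand_def conjugate_def by (rule SUP_least)
    qed
    then have "?J v \<le> upper_integral M (\<lambda>t. ereal (l t + h t - a t))"
      unfolding integral_functional_def by (rule upper_integral_mono_AE)
    also have "\<dots> = ereal (LINT t|M. l t + h t - a t)"
      using lint(1) h a(1) by (intro upper_integral_integrable) simp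
    also have "(LINT t|M. l t + h t - a t) = (LINT t|M. l t) + (LINT t|M. h t) - (LINT t|M. a t)"
      using lint(1) h a(1) by simp
    finally have J: "?J v \<le> ereal ((LINT t|M. l t) + (LINT t|M. h t) - (LINT t|M. a t))" .
    have \<sigma>: "?\<sigma> \<le> ereal (ls x + \<epsilon>2)"
    proof (rule support_fun_least)
      fix z assume z: "z \<in> dom_I"
      then have zL: "z \<in> Linf_space M" using sub by blast
      have "\<forall>y\<in>Linf_space M. ereal (ls (y - x)) \<le> indicator_delta dom_I y - indicator_delta dom_I x + ereal \<epsilon>2"
        using normal unfolding eps_normal_def eps_subdiff_def by (simp split: if_splits)
      with zL have "ereal (ls (z - x)) \<le> indicator_delta dom_I z - indicator_delta dom_I x + ereal \<epsilon>2"
        by blast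
      then show "ereal (ls z) \<le> ereal (ls x + \<epsilon>2)"
        using z x by (simp add: indicator_delta_def Linf_dual_diff[OF lsL zL xL(1)])
    qed
    have "?J v + ?\<sigma> \<le> ereal ((LINT t|M. l t) + (LINT t|M. h t) - (LINT t|M. a t)) + ereal (ls x + \<epsilon>2)"
      by (rule add_mono[OF J \<sigma>])
    also have "\<dots> \<le> ereal (?\<Lambda> x - (LINT t|M. a t) + \<epsilon>)"
      using eps lint(2) by (simp add: vx)
    finally show "?\<Lambda> \<in> ?sub" unfolding split .
  qed
qed

end

theorem theorem6p7:
  fixes M :: "'t::metric_space measure"
    and f :: "'t \<Rightarrow> 'x::banach \<Rightarrow> ereal"
  assumes "space M = UNIV"
    and "sets borel \<subseteq> sets M"
    and "complete_measure M"
    and "sigma_finite_measure M"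
    and "inner_regular_measure M"
    and "Asplund_space TYPE('x)"
    and "admissible_integrand M f"
    and "\<exists>u\<in>Linf_space M. integral_functional M f u < \<infinity>"
  shows "(\<forall>xs\<in>L1_space M. \<forall>ls\<in>Lsing M.
            conjugate (Linf_space M) (integral_functional M f) (\<lambda>u. L1_functional M xs u + ls u)
              = integral_functional M (conjugate_integrand f) xs
                + support_fun (Linf_space M) (dom_integral_functional M f) ls)
       \<and> (\<forall>\<epsilon>\<ge>0. \<forall>x\<in>dom_integral_functional M f. integral_functional M f x \<noteq> - \<infinity> \<longrightarrow>
            (\<forall>vs\<in>L1_space M. \<forall>ls\<in>Lsing M.
               (\<lambda>u. L1_functional M vs u + ls u)
                   \<in> eps_subdiff (Linf_space M) (Linf_dual M) \<epsilon> (integral_functional M f) x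
               \<longleftrightarrow> (\<exists>\<epsilon>1 \<epsilon>2. 0 \<le> \<epsilon>1 \<and> 0 \<le> \<epsilon>2 \<and> \<epsilon>1 + \<epsilon>2 \<le> \<epsilon> \<and>
                     (\<exists>l\<in>Z_set M \<epsilon>1.
                        (AE t in M. blinfun_apply (vs t)
                           \<in> eps_subdiff UNIV (Collect bounded_linear) (l t) (f t) (x t)) \<and>
                        ls \<in> eps_normal (Linf_space M) (Linf_dual M) \<epsilon>2
                               (dom_integral_functional M f) x))))"
proof -
  interpret normal_integrand M f
    by (intro normal_integrand.intro complete_borel_measure.intro complete_borel_measure_axioms.intro
        normal_integrand_axioms.intro assms admissible_integrand_epi[OF assms(7)])
  have "dom_integral_functional M f \<noteq> {}"
    using assms(8) by (auto simp: dom_integral_functional_def)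
  then show ?thesis
    using conjugate_integral_functional eps_subdiff_integral_functional by blast
qed

end
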